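(* Let $\Omega\subset\mathbb{R}^{2n+1}$ be open. For any compact domain $\Omega'\Subset\Omega$ there exists a positive constant $C$, depending on $\Omega'$ and $\Omega$ only and independent of $u$, such that for every $\sigma_2(\mathcal{H})$-convex function $u\in C^2(\Omega)$, $$\int_{\Omega'}\left\{\sigma_2(\mathcal{H}(u))+12\,n\,(\partial_t u)^2\right\}dz\leq C\,\bigl(\operatorname{osc}_\Omega u\bigr)^2 .$$
   Context: Let $n\ge 1$ and write points of $\mathbb{R}^{2n+1}$ (the Heisenberg group $\mathbb{H}^n$) as $(x,y,t)\in\mathbb{R}^n\times\mathbb{R}^n\times\mathbb{R}$; $dz$ is Lebesgue measure on $\mathbb{R}^{2n+1}$. The Heisenberg vector fields are $$X_j=\partial_{x_j}+2y_j\,\partial_t,\qquad X_{n+j}=\partial_{y_j}-2x_j\,\partial_t,\qquad j=1,\dots,n.$$ For a $C^2$ function $u$, $\mathcal{H}(u)$ is the $2n\times 2n$ symmetric matrix $\mathcal{H}(u)=\left[\frac{X_iX_ju+X_jX_iu}{2}\right]_{i,j=1}^{2n}$, and $\sigma_2(\mathcal{H}(u))$ is the second elementary symmetric function of its eigenvalues: $$\sigma_2(\mathcal{H}(u))=\sum_{1\le i<j\le 2n}\left\{X_i^2u\,X_j^2u-\left(\frac{X_iX_ju+X_jX_iu}{2}\right)^2\right\}.$$ A function $u\in C^2(\Omega)$ is $\sigma_2(\mathcal{H})$-convex in $\Omega$ if $\operatorname{trace}\mathcal{H}(u)\ge 0$ and $\sigma_2(\mathcal{H}(u))\ge 0$ in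 $\Omega$. Here $\operatorname{osc}_\Omega u=\sup_\Omega u-\inf_\Omega u\in[0,\infty]$ (the inequality being trivial when it is infinite), and $\Omega'\Subset\Omega$ means that the closure of $\Omega'$ is compact and contained in $\Omega$. *)

theory Defs
  imports "HOL-Analysis.Analysis"
begin

text \<open>Points \<open>(x, y, t)\<close> of the Heisenberg group; \<open>n\<close> is \<open>CARD('n) \<ge> 1\<close>.\<close>

type_synonym 'n heisenberg = "(real ^ 'n) \<times> (real ^ 'n) \<times> real"

definition C2_on :: "'a::real_normed_vector set \<Rightarrow> ('a \<Rightarrow> real) \<Rightarrow> bool" where
  "C2_on S f \<longleftrightarrow>
    (\<exists>(f' :: 'a \<Rightarrow> 'a \<Rightarrow>\<^sub>L real) (f'' :: 'a \<Rightarrow> 'a \<Rightarrow>\<^sub>L 'a \<Rightarrow>\<^sub>L real).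
      (\<forall>z\<in>S. (f has_derivative blinfun_apply (f' z)) (at z)) \<and>
      (\<forall>z\<in>S. (f' has_derivative blinfun_apply (f'' z)) (at z)) \<and>
      continuous_on S f'')"

definition dir_deriv :: "'a::real_normed_vector \<Rightarrow> ('a \<Rightarrow> real) \<Rightarrow> 'a \<Rightarrow> real" where
  "dir_deriv v f z = deriv (\<lambda>s. f (z + s *\<^sub>R v)) 0"

definition dx :: "'n \<Rightarrow> ('n::finite heisenberg \<Rightarrow> real) \<Rightarrow> 'n heisenberg \<Rightarrow> real" where
  "dx j = dir_deriv (axis j 1, 0, 0)"

definition dy :: "'n \<Rightarrow> ('n::finite heisenberg \<Rightarrow> real) \<Rightarrow> 'n heisenberg \<Rightarrow> real" where
  "dy j = dir_deriv (0, axis j 1, 0)"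

definition dt :: "('n::finite heisenberg \<Rightarrow> real) \<Rightarrow> 'n heisenberg \<Rightarrow> real" where
  "dt = dir_deriv (0, 0, 1)"

text \<open>The \<open>2n\<close> fields are indexed by \<open>'n + 'n\<close>:
  \<open>Inl j\<close> is the index \<open>j\<close> and \<open>Inr j\<close> is the index \<open>n + j\<close>.\<close>

fun X :: "'n + 'n \<Rightarrow> ('n::finite heisenberg \<Rightarrow> real) \<Rightarrow> 'n heisenberg \<Rightarrow> real" where
  "X (Inl j) u (x, y, t) = dx j u (x, y, t) + 2 * (y $ j) * dt u (x, y, t)"
| "X (Inr j) u (x, y, t) = dy j u (x, y, t) - 2 * (x $ j) * dt u (x, y, t)"

definition heis_hessian ::
  "('n::finite heisenberg \<Rightarrow> real) \<Rightarrow> 'n heisenberg \<Rightarrow> real ^ ('n + 'n) ^ ('n + 'n)" where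
  "heis_hessian u z = (\<chi> i j. (X i (X j u) z + X j (X i u) z) / 2)"

text \<open>The index type carries no order, so the sum over \<open>i < j\<close> uses the enumeration
  \<open>to_nat\<close>; by \<open>sigma2_eq_half_sum\<close> below the choice of enumeration is
  irrelevant.\<close>

definition sigma2 :: "real ^ 'k ^ 'k::finite \<Rightarrow> real" where
  "sigma2 A = (\<Sum>(i, j) | to_nat i < to_nat j. A $ i $ i * A $ j $ j - (A $ i $ j)\<^sup>2)"

lemma sigma2_eq_half_sum:
  fixes A :: "real ^ 'k ^ 'k::finite"
  assumes "transpose A = A"
  shows "sigma2 A = (\<Sum>(i, j) | i \<noteq> j. A $ i $ i * A $ j $ j - (A $ i $ j)\<^sup>2) / 2"
proof -
  define f where "f = (\<lambda>(i, j). A $ i $ i * A $ j $ j - (A $ i $ j)\<^sup>2)"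
  let ?L = "{(i :: 'k, j). to_nat i < to_nat j}"
  let ?G = "{(i :: 'k, j). to_nat j < to_nat i}"
  have sym: "A $ i $ j = A $ j $ i" for i j
    using assms by (metis transpose_def vec_lambda_beta)
  have "sum f ?G = sum f ?L"
    by (rule sum.reindex_bij_witness[of _ prod.swap prod.swap])
      (auto simp: f_def sym mult.commute)
  moreover have "{(i :: 'k, j). i \<noteq> j} = ?L \<union> ?G"
    by auto (metis linorder_neqE_nat to_nat_split)
  moreover have "sum f (?L \<union> ?G) = sum f ?L + sum f ?G"
    by (rule sum.union_disjoint) auto
  ultimately show ?thesis
    by (simp add: sigma2_def f_def)
qed

definition sigma2_H_convex_on :: "'n::finite heisenberg set \<Rightarrow> ('n heisenberg \<Rightarrow> real) \<Rightarrow> bool" where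
  "sigma2_H_convex_on S u \<longleftrightarrow>
    C2_on S u \<and> (\<forall>z\<in>S. trace (heis_hessian u z) \<ge> 0 \<and> sigma2 (heis_hessian u z) \<ge> 0)"

definition osc :: "'a set \<Rightarrow> ('a \<Rightarrow> real) \<Rightarrow> ereal" where
  "osc S u = (SUP z\<in>S. ereal (u z)) - (INF z\<in>S. ereal (u z))"

end

theory Submission
  imports Defs
begin

text \<open>
  Write \<open>f i = X i u\<close> and \<open>T = dt u\<close>. For a cutoff \<open>\<phi>\<close>, the integral of \<open>2 \<phi> (\<sigma>\<^sub>2 + 12 n T\<^sup>2)\<close> can be
  integrated by parts twice; the commutators \<open>[X i, X j]\<close> produce exactly the term \<open>24 n T\<^sup>2\<close>, and
  what remains is quadratic in \<open>f\<close> with second derivatives of \<open>\<phi>\<close> as coefficients, up to a term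
  of the form \<open>X j \<phi> * f i * T\<close>. With \<open>\<phi> = \<eta>\<^sup>2\<close> that term is absorbed by half of the left-hand side,
  since \<open>\<sigma>\<^sub>2 \<ge> 0\<close>. As the trace is nonnegative, \<open>u\<close> is subharmonic for the sub-Laplacian and
  Caccioppoli's inequality bounds the remaining integral of \<open>\<bar>f\<bar>\<^sup>2\<close> by the squared oscillation.

  Only second derivatives of \<open>u\<close> exist, so the identity cannot be obtained by differentiating
  \<open>\<sigma>\<^sub>2\<close>. It rests on the symmetry of \<open>\<integral> D\<^sub>a F D\<^sub>b G\<close> in \<open>a\<close> and \<open>b\<close> for \<open>C\<^sup>1\<close> functions,
  which follows from difference quotients and translation invariance.
\<close>

section \<open>Continuously differentiable functions\<close>

text \<open>Stated through directional derivatives, so that differentiating again gives real-valued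
  functions of the same kind. In finite dimension, continuity in every fixed direction amounts to
  continuity of the derivative.\<close>

definition C1_fun_on :: "'a::euclidean_space set \<Rightarrow> ('a \<Rightarrow> real) \<Rightarrow> bool" where
  "C1_fun_on S f \<longleftrightarrow>
    (\<forall>z\<in>S. f differentiable (at z)) \<and> (\<forall>v. continuous_on S (dir_deriv v f))"

definition C2_fun_on :: "'a::euclidean_space set \<Rightarrow> ('a \<Rightarrow> real) \<Rightarrow> bool" where
  "C2_fun_on S f \<longleftrightarrow> C1_fun_on S f \<and> (\<forall>v. C1_fun_on S (dir_deriv v f))"

definition compactly_supported :: "('a::topological_space \<Rightarrow> real) \<Rightarrow> bool" where
  "compactly_supported f \<longleftrightarrow> (\<exists>K. compact K \<and> (\<forall>z. z \<notin> K \<longrightarrow> f z = 0))"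

lemma has_real_derivative_along_line:
  assumes "(f has_derivative f') (at (z + s *\<^sub>R v))"
  shows "((\<lambda>s. f (z + s *\<^sub>R v)) has_real_derivative f' v) (at s)"
proof -
  have "((\<lambda>s. f (z + s *\<^sub>R v)) has_derivative (\<lambda>r. f' (r *\<^sub>R v))) (at s)"
    by (rule has_derivative_compose[where g = f]) (auto intro!: derivative_eq_intros assms)
  moreover have "f' (r *\<^sub>R v) = r * f' v" for r
    using has_derivative_linear[OF assms] by (simp add: linear_cmul)
  moreover have "(*) (f' v) = (\<lambda>r. r * f' v)"
    by (simp add: fun_eq_iff mult.commute)
  ultimately show ?thesis
    by (simp add: has_field_derivative_def)
qed

lemma dir_deriv_eq:
  assumes "(f has_derivative f') (at z)"
  shows "dir_deriv v f z = f' v"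
  unfolding dir_deriv_def
  using has_real_derivative_along_line[of f f' z 0 v] assms by (auto intro: DERIV_imp_deriv)

lemma has_derivative_dir_deriv:
  assumes "f differentiable (at z)"
  shows "(f has_derivative (\<lambda>v. dir_deriv v f z)) (at z)"
proof -
  obtain f' where f': "(f has_derivative f') (at z)"
    using assms by (auto simp: differentiable_def)
  then have "f' = (\<lambda>v. dir_deriv v f z)"
    by (simp add: fun_eq_iff dir_deriv_eq[OF f'])
  with f' show ?thesis
    by simp
qed

lemma dir_deriv_cong:
  assumes "open S" "z \<in> S" "\<And>w. w \<in> S \<Longrightarrow> f w = g w"
  shows "dir_deriv v f z = dir_deriv v g z"
proof -
  have "((\<lambda>s. z + s *\<^sub>R v) \<longlongrightarrow> z + 0 *\<^sub>R v) (nhds 0)"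
    by (intro tendsto_intros filterlim_ident)
  then have "\<forall>\<^sub>F s in nhds 0. z + s *\<^sub>R v \<in> S"
    using assms(1,2) by (auto dest: topological_tendstoD)
  then have "\<forall>\<^sub>F s in nhds 0. f (z + s *\<^sub>R v) = g (z + s *\<^sub>R v)"
    by eventually_elim (use assms in auto)
  then show ?thesis
    unfolding dir_deriv_def by (rule deriv_cong_ev) simp
qed

lemma differentiable_cong_open:
  assumes "open S" "z \<in> S" "\<And>w. w \<in> S \<Longrightarrow> f w = g w" "f differentiable (at z)"
  shows "g differentiable (at z)"
proof -
  obtain f' where "(f has_derivative f') (at z)"
    using assms(4) by (auto simp: differentiable_def)
  then have "(g has_derivative f') (at z)"
    by (rule has_derivative_transform_within_open[OF _ assms(1,2)]) (rule assms(3))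
  then show ?thesis
    by (auto simp: differentiable_def)
qed

lemma C1_fun_on_cong:
  assumes "open S" "\<And>z. z \<in> S \<Longrightarrow> f z = g z" "C1_fun_on S f"
  shows "C1_fun_on S g"
proof -
  have "dir_deriv v f z = dir_deriv v g z" if "z \<in> S" for v z
    by (rule dir_deriv_cong[OF assms(1) that assms(2)])
  then have "continuous_on S (dir_deriv v g)" for v
    using assms(3) unfolding C1_fun_on_def by (metis continuous_on_eq)
  moreover have "g differentiable (at z)" if "z \<in> S" for z
    using assms(3) that
    by (intro differentiable_cong_open[OF assms(1) that assms(2)]) (auto simp: C1_fun_on_def)
  ultimately show ?thesis
    by (simp add: C1_fun_on_def)
qed

lemma C2_fun_on_cong:
  assumes "open S" "\<And>z. z \<in> S \<Longrightarrow> f z = g z" "C2_fun_on S f"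
  shows "C2_fun_on S g"
proof -
  have "C1_fun_on S (dir_deriv v g)" for v
  proof (rule C1_fun_on_cong[OF assms(1)])
    show "dir_deriv v f z = dir_deriv v g z" if "z \<in> S" for z
      by (rule dir_deriv_cong[OF assms(1) that assms(2)])
    show "C1_fun_on S (dir_deriv v f)"
      using assms(3) by (simp add: C2_fun_on_def)
  qed
  moreover have "C1_fun_on S g"
    using assms(3) by (intro C1_fun_on_cong[OF assms(1,2)]) (auto simp: C2_fun_on_def)
  ultimately show ?thesis
    by (simp add: C2_fun_on_def)
qed

lemma C1_fun_on_Un:
  assumes "open S" "open T" "C1_fun_on S f" "C1_fun_on T f"
  shows "C1_fun_on (S \<union> T) f"
proof -
  have "continuous_on (S \<union> T) (dir_deriv v f)" for v
    using assms by (intro continuous_on_open_Un) (auto simp: C1_fun_on_def)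
  with assms show ?thesis
    by (auto simp: C1_fun_on_def)
qed

lemma C2_fun_on_Un:
  assumes "open S" "open T" "C2_fun_on S f" "C2_fun_on T f"
  shows "C2_fun_on (S \<union> T) f"
  using assms by (auto simp: C2_fun_on_def intro!: C1_fun_on_Un)

lemma C1_fun_on_subset: "C1_fun_on S f \<Longrightarrow> T \<subseteq> S \<Longrightarrow> C1_fun_on T f"
  by (auto simp: C1_fun_on_def intro: continuous_on_subset)

lemma C2_fun_on_subset: "C2_fun_on S f \<Longrightarrow> T \<subseteq> S \<Longrightarrow> C2_fun_on T f"
  by (auto simp: C2_fun_on_def intro: C1_fun_on_subset)

lemma C2_fun_on_imp_C1: "C2_fun_on S f \<Longrightarrow> C1_fun_on S f"
  by (simp add: C2_fun_on_def)

lemma C1_fun_on_dir_deriv: "C2_fun_on S f \<Longrightarrow> C1_fun_on S (dir_deriv v f)"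
  by (simp add: C2_fun_on_def)

lemma C1_fun_on_imp_continuous: "C1_fun_on S f \<Longrightarrow> continuous_on S f"
  by (auto simp: C1_fun_on_def
      intro!: continuous_at_imp_continuous_on differentiable_imp_continuous_within)

lemma C1_fun_on_imp_differentiable:
  "C1_fun_on S f \<Longrightarrow> z \<in> S \<Longrightarrow> f differentiable (at z)"
  by (simp add: C1_fun_on_def)

lemma continuous_on_dir_deriv: "C1_fun_on S f \<Longrightarrow> continuous_on S (dir_deriv v f)"
  by (simp add: C1_fun_on_def)

lemma C1_fun_onI:
  assumes "\<And>z. z \<in> S \<Longrightarrow> (f has_derivative f' z) (at z)"
    and "\<And>v. continuous_on S (\<lambda>z. f' z v)"
  shows "C1_fun_on S f"
proof -
  have "continuous_on S (dir_deriv v f)" for v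
    using assms(2)[of v] by (rule continuous_on_eq) (simp add: dir_deriv_eq[OF assms(1)])
  with assms(1) show ?thesis
    unfolding C1_fun_on_def differentiable_def by blast
qed

lemma C2_fun_onI:
  assumes "open S" "\<And>z. z \<in> S \<Longrightarrow> (f has_derivative f' z) (at z)"
    and "\<And>v. C1_fun_on S (\<lambda>z. f' z v)"
  shows "C2_fun_on S f"
proof -
  have "C1_fun_on S (dir_deriv v f)" for v
    by (rule C1_fun_on_cong[OF assms(1) _ assms(3)]) (simp add: dir_deriv_eq[OF assms(2)])
  moreover have "C1_fun_on S f"
    by (rule C1_fun_onI[OF assms(2)]) (auto intro: C1_fun_on_imp_continuous assms(3))
  ultimately show ?thesis
    by (simp add: C2_fun_on_def)
qed

section \<open>Closure properties of the two differentiability classes\<close>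

lemma C1_fun_on_const: "C1_fun_on S (\<lambda>z. c)"
  by (rule C1_fun_onI[where f' = "\<lambda>z v. 0"]) auto

lemma C2_fun_on_const: "open S \<Longrightarrow> C2_fun_on S (\<lambda>z. c)"
  by (rule C2_fun_onI[where f' = "\<lambda>z v. 0"]) (auto intro: C1_fun_on_const)

lemma C1_fun_on_bounded_linear: "bounded_linear f \<Longrightarrow> C1_fun_on S f"
  by (rule C1_fun_onI[where f' = "\<lambda>z. f"]) (auto intro: bounded_linear_imp_has_derivative)

lemma C1_fun_on_add:
  assumes "C1_fun_on S f" "C1_fun_on S g"
  shows "C1_fun_on S (\<lambda>z. f z + g z)"
proof (rule C1_fun_onI)
  show "((\<lambda>z. f z + g z) has_derivative (\<lambda>v. dir_deriv v f z + dir_deriv v g z)) (at z)"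
    if "z \<in> S" for z
    using assms that by (intro has_derivative_add has_derivative_dir_deriv)
      (auto simp: C1_fun_on_def)
  show "continuous_on S (\<lambda>z. dir_deriv v f z + dir_deriv v g z)" for v
    using assms by (intro continuous_on_add continuous_on_dir_deriv)
qed

lemma C1_fun_on_mult:
  assumes "C1_fun_on S f" "C1_fun_on S g"
  shows "C1_fun_on S (\<lambda>z. f z * g z)"
proof (rule C1_fun_onI)
  show "((\<lambda>z. f z * g z) has_derivative
      (\<lambda>v. f z * dir_deriv v g z + dir_deriv v f z * g z)) (at z)" if "z \<in> S" for z
    using assms that by (intro has_derivative_mult has_derivative_dir_deriv)
      (auto simp: C1_fun_on_def)
  show "continuous_on S (\<lambda>z. f z * dir_deriv v g z + dir_deriv v f z * g z)" for v
    using assms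
    by (intro continuous_on_add continuous_on_mult continuous_on_dir_deriv C1_fun_on_imp_continuous)
qed

lemma C1_fun_on_cmult: "C1_fun_on S f \<Longrightarrow> C1_fun_on S (\<lambda>z. c * f z)"
  by (rule C1_fun_on_mult[OF C1_fun_on_const])

lemma C1_fun_on_diff:
  assumes "C1_fun_on S f" "C1_fun_on S g"
  shows "C1_fun_on S (\<lambda>z. f z - g z)"
  using C1_fun_on_add[OF assms(1) C1_fun_on_cmult[OF assms(2), of "-1"]] by simp

lemma C2_fun_on_add:
  assumes "open S" "C2_fun_on S f" "C2_fun_on S g"
  shows "C2_fun_on S (\<lambda>z. f z + g z)"
proof (rule C2_fun_onI[OF assms(1)])
  show "((\<lambda>z. f z + g z) has_derivative (\<lambda>v. dir_deriv v f z + dir_deriv v g z)) (at z)"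
    if "z \<in> S" for z
    using assms that by (intro has_derivative_add has_derivative_dir_deriv)
      (auto simp: C1_fun_on_def C2_fun_on_def)
  show "C1_fun_on S (\<lambda>z. dir_deriv v f z + dir_deriv v g z)" for v
    using assms by (intro C1_fun_on_add C1_fun_on_dir_deriv)
qed

lemma C2_fun_on_mult:
  assumes "open S" "C2_fun_on S f" "C2_fun_on S g"
  shows "C2_fun_on S (\<lambda>z. f z * g z)"
proof (rule C2_fun_onI[OF assms(1)])
  show "((\<lambda>z. f z * g z) has_derivative
      (\<lambda>v. f z * dir_deriv v g z + dir_deriv v f z * g z)) (at z)" if "z \<in> S" for z
    using assms that by (intro has_derivative_mult has_derivative_dir_deriv)
      (auto simp: C1_fun_on_def C2_fun_on_def)
  show "C1_fun_on S (\<lambda>z. f z * dir_deriv v g z + dir_deriv v f z * g z)" for v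
    using assms by (intro C1_fun_on_add C1_fun_on_mult)
      (auto simp: C1_fun_on_dir_deriv C2_fun_on_imp_C1)
qed

lemma C2_fun_on_sum:
  assumes "open S" "finite I" "\<And>i. i \<in> I \<Longrightarrow> C2_fun_on S (f i)"
  shows "C2_fun_on S (\<lambda>z. \<Sum>i\<in>I. f i z)"
  using assms(2,3) by (induction I rule: finite_induct)
    (auto intro!: C2_fun_on_add C2_fun_on_const assms(1))

text \<open>Away from 0 the function is locally zero or a monomial. At 0 the difference quotient is
  bounded by \<open>(max 0 y) ^ n\<close>, which tends to 0 because \<open>n > 0\<close>.\<close>

lemma has_real_derivative_max_0_power:
  fixes t :: real
  assumes "n > 0"
  shows "((\<lambda>t. (max 0 t) ^ Suc n) has_real_derivative (real (Suc n) * (max 0 t) ^ n)) (at t)"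
proof -
  consider "t < 0" | "t > 0" | "t = 0" by linarith
  then show ?thesis
  proof cases
    case 1
    have "((\<lambda>t. 0) has_real_derivative 0) (at t)" by simp
    then have "((\<lambda>t. (max 0 t) ^ Suc n) has_real_derivative 0) (at t)"
      by (rule has_field_derivative_transform_within_open[of _ _ _ "{..<0}"]) (use 1 in auto)
    with 1 assms show ?thesis by (simp add: power_0_left del: power_Suc)
  next
    case 2
    have "((\<lambda>t. t ^ Suc n) has_real_derivative (real (Suc n) * t ^ n)) (at t)"
      by (auto intro!: derivative_eq_intros simp del: power_Suc)
    then have "((\<lambda>t. (max 0 t) ^ Suc n) has_real_derivative (real (Suc n) * t ^ n)) (at t)"
      by (rule has_field_derivative_transform_within_open[of _ _ _ "{0<..}"]) (use 2 in auto)
    with 2 assms show ?thesis by (simp del: power_Suc)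
  next
    case 3
    have "((\<lambda>y. (max 0 y) ^ n) \<longlongrightarrow> (max 0 0) ^ n) (at (0::real))"
      by (intro tendsto_intros)
    then have lim: "((\<lambda>y. (max 0 y) ^ n) \<longlongrightarrow> 0) (at (0::real))"
      using assms by (simp only: max.idem power_0_left) simp
    have "norm ((max 0 y) ^ Suc n / y) \<le> (max 0 y) ^ n" for y :: real
      using assms by (cases "y > 0") (simp_all add: max_def)
    then have "((\<lambda>y. (max 0 y) ^ Suc n / y) \<longlongrightarrow> 0) (at (0::real))"
      by (intro Lim_null_comparison[OF _ lim] always_eventually) simp
    with 3 assms show ?thesis
      by (simp add: has_field_derivative_iff power_0_left del: power_Suc)
  qed
qed

text \<open>Three is the least exponent for which the power of the positive part is twice
  continuously differentiable. All cutoffs below are built from such cubes.\<close>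

lemma C2_fun_on_max_0_cube:
  assumes "open S" "C2_fun_on S f"
  shows "C2_fun_on S (\<lambda>z. (max 0 (f z)) ^ 3)"
proof (rule C2_fun_onI[OF assms(1)])
  fix z assume "z \<in> S"
  then have f: "(f has_derivative (\<lambda>v. dir_deriv v f z)) (at z)"
    using assms(2) by (simp add: C2_fun_on_def C1_fun_on_def has_derivative_dir_deriv)
  have "((\<lambda>t. (max 0 t) ^ 3) has_real_derivative (3 * (max 0 (f z)) ^ 2)) (at (f z))"
    using has_real_derivative_max_0_power[of 2] by (simp add: numeral_3_eq_3)
  from has_derivative_compose[OF f this[unfolded has_field_derivative_def]]
  show "((\<lambda>z. (max 0 (f z)) ^ 3) has_derivative
      (\<lambda>v. 3 * (max 0 (f z)) ^ 2 * dir_deriv v f z)) (at z)" .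
next
  fix v
  have "C1_fun_on S (\<lambda>z. (max 0 (f z)) ^ 2)"
  proof (rule C1_fun_onI)
    fix z assume "z \<in> S"
    then have f: "(f has_derivative (\<lambda>v. dir_deriv v f z)) (at z)"
      using assms(2) by (simp add: C2_fun_on_def C1_fun_on_def has_derivative_dir_deriv)
    have "((\<lambda>t. (max 0 t) ^ 2) has_real_derivative (2 * max 0 (f z))) (at (f z))"
      using has_real_derivative_max_0_power[of 1] by (simp add: numeral_2_eq_2)
    from has_derivative_compose[OF f this[unfolded has_field_derivative_def]]
    show "((\<lambda>z. (max 0 (f z)) ^ 2) has_derivative
        (\<lambda>v. 2 * max 0 (f z) * dir_deriv v f z)) (at z)" .
  next
    show "continuous_on S (\<lambda>z. 2 * max 0 (f z) * dir_deriv v f z)" for v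
      using assms(2) by (intro continuous_intros)
        (auto simp: C2_fun_on_def continuous_on_dir_deriv C1_fun_on_imp_continuous)
  qed
  then show "C1_fun_on S (\<lambda>z. 3 * (max 0 (f z)) ^ 2 * dir_deriv v f z)"
    using assms(2) by (intro C1_fun_on_mult C1_fun_on_cmult) (auto simp: C2_fun_on_def)
qed

text \<open>The bridge from the class used in the statement of the theorem: evaluation at fixed
  vectors turns the operator-valued derivatives into directional ones.\<close>

lemma C2_on_imp_C2_fun_on:
  assumes "open S" "C2_on S f"
  shows "C2_fun_on S f"
proof -
  obtain f' :: "'a \<Rightarrow> 'a \<Rightarrow>\<^sub>L real" and f'' :: "'a \<Rightarrow> 'a \<Rightarrow>\<^sub>L 'a \<Rightarrow>\<^sub>L real"
    where f': "\<And>z. z \<in> S \<Longrightarrow> (f has_derivative blinfun_apply (f' z)) (at z)"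
      and f'': "\<And>z. z \<in> S \<Longrightarrow> (f' has_derivative blinfun_apply (f'' z)) (at z)"
      and cont: "continuous_on S f''"
    using assms(2) unfolding C2_on_def by blast
  show ?thesis
  proof (rule C2_fun_onI[OF assms(1) f'])
    fix v
    show "C1_fun_on S (\<lambda>z. blinfun_apply (f' z) v)"
    proof (rule C1_fun_onI)
      fix z assume "z \<in> S"
      from f''[OF this] show "((\<lambda>z. blinfun_apply (f' z) v) has_derivative
          (\<lambda>w. blinfun_apply (blinfun_apply (f'' z) w) v)) (at z)"
        by (auto intro!: derivative_eq_intros)
    next
      show "continuous_on S (\<lambda>z. blinfun_apply (blinfun_apply (f'' z) w) v)" for w
        by (intro continuous_intros cont)
    qed
  qed
qed

lemma dir_deriv_mult:
  assumes "f differentiable (at z)" "g differentiable (at z)"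
  shows "dir_deriv v (\<lambda>z. f z * g z) z = f z * dir_deriv v g z + dir_deriv v f z * g z"
  by (rule dir_deriv_eq) (intro has_derivative_mult has_derivative_dir_deriv assms)

lemma dir_deriv_add:
  assumes "f differentiable (at z)" "g differentiable (at z)"
  shows "dir_deriv v (\<lambda>z. f z + g z) z = dir_deriv v f z + dir_deriv v g z"
  by (rule dir_deriv_eq) (intro has_derivative_add has_derivative_dir_deriv assms)

lemma dir_deriv_diff:
  assumes "f differentiable (at z)" "g differentiable (at z)"
  shows "dir_deriv v (\<lambda>z. f z - g z) z = dir_deriv v f z - dir_deriv v g z"
  by (rule dir_deriv_eq) (intro has_derivative_diff has_derivative_dir_deriv assms)

lemma dir_deriv_bounded_linear: "bounded_linear f \<Longrightarrow> dir_deriv v f z = f v"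
  by (rule dir_deriv_eq) (rule bounded_linear_imp_has_derivative)

lemma dir_deriv_const: "dir_deriv v (\<lambda>z. c) z = 0"
  by (simp add: dir_deriv_def)

section \<open>Compact supports and integrability\<close>

lemma dir_deriv_eq_0_outside:
  assumes "compact K" "\<And>z. z \<notin> K \<Longrightarrow> f z = 0" "z \<notin> K"
  shows "dir_deriv v f z = 0"
proof -
  have "dir_deriv v f z = dir_deriv v (\<lambda>z. 0) z"
    by (rule dir_deriv_cong[of "- K"]) (use assms in \<open>auto simp: compact_imp_closed\<close>)
  then show ?thesis
    by (simp add: dir_deriv_const)
qed

lemma compactly_supported_dir_deriv:
  "compactly_supported f \<Longrightarrow> compactly_supported (dir_deriv v f)"
  unfolding compactly_supported_def by (meson dir_deriv_eq_0_outside)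

lemma compactly_supported_mult:
  "compactly_supported f \<Longrightarrow> compactly_supported (\<lambda>z. f z * g z)"
  "compactly_supported g \<Longrightarrow> compactly_supported (\<lambda>z. f z * g z)"
  unfolding compactly_supported_def by (metis mult_zero_left mult_zero_right)+

lemma compactly_supported_add:
  assumes "compactly_supported f" "compactly_supported g"
  shows "compactly_supported (\<lambda>z. f z + g z)"
proof -
  obtain K L where "compact K" "\<forall>z. z \<notin> K \<longrightarrow> f z = 0" "compact L" "\<forall>z. z \<notin> L \<longrightarrow> g z = 0"
    using assms unfolding compactly_supported_def by auto
  then show ?thesis
    unfolding compactly_supported_def by (intro exI[of _ "K \<union> L"]) auto
qed

lemma compactly_supported_bounded:
  fixes f :: "'a::topological_space \<Rightarrow> real"
  assumes "compactly_supported f" "continuous_on UNIV f"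
  obtains M where "M \<ge> 0" "\<And>z. \<bar>f z\<bar> \<le> M"
proof -
  obtain K where K: "compact K" "\<And>z. z \<notin> K \<Longrightarrow> f z = 0"
    using assms(1) unfolding compactly_supported_def by auto
  have "bounded (f ` K)"
    using K(1) assms(2) by (meson compact_continuous_image compact_imp_bounded continuous_on_subset subset_UNIV)
  then obtain M where M: "\<And>z. z \<in> K \<Longrightarrow> \<bar>f z\<bar> \<le> M"
    by (auto simp: bounded_iff)
  have "\<bar>f z\<bar> \<le> max 0 M" for z
    using M[of z] K(2)[of z] by (cases "z \<in> K") auto
  then show ?thesis
    using that[of "max 0 M"] by simp
qed

lemma integrable_compactly_supported:
  fixes f :: "'a::euclidean_space \<Rightarrow> real"
  assumes "compactly_supported f" "continuous_on UNIV f"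
  shows "integrable lborel f"
proof -
  obtain K where K: "compact K" "\<And>z. z \<notin> K \<Longrightarrow> f z = 0"
    using assms(1) unfolding compactly_supported_def by auto
  have "integrable lborel (\<lambda>z. indicator K z *\<^sub>R f z)"
    by (rule borel_integrable_compact) (use K assms in \<open>auto intro: continuous_on_subset\<close>)
  moreover have "(\<lambda>z. indicator K z *\<^sub>R f z) = f"
    using K(2) by (auto simp: indicator_def fun_eq_iff)
  ultimately show ?thesis by simp
qed

section \<open>Mean values, translations and symmetry of second derivatives\<close>

lemma mvt_dir_deriv:
  assumes "C1_fun_on UNIV f" "h \<noteq> 0"
  obtains s where "\<bar>s\<bar> \<le> \<bar>h\<bar>" "f (z + h *\<^sub>R v) - f z = h * dir_deriv v f (z + s *\<^sub>R v)"
proof -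
  have D: "((\<lambda>s. f (z + s *\<^sub>R v)) has_real_derivative dir_deriv v f (z + s *\<^sub>R v)) (at s)" for s
    using assms(1) by (intro has_real_derivative_along_line has_derivative_dir_deriv)
      (simp add: C1_fun_on_def)
  show ?thesis
  proof (cases "h > 0")
    case True
    then obtain s where "0 < s" "s < h"
      "f (z + h *\<^sub>R v) - f (z + 0 *\<^sub>R v) = (h - 0) * dir_deriv v f (z + s *\<^sub>R v)"
      using MVT2[of 0 h, OF _ D] by blast
    with that[of s] show ?thesis by simp
  next
    case False
    with assms(2) have "h < 0" by simp
    then obtain s where "h < s" "s < 0"
      "f (z + 0 *\<^sub>R v) - f (z + h *\<^sub>R v) = (0 - h) * dir_deriv v f (z + s *\<^sub>R v)"
      using MVT2[of h 0, OF _ D] by blast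
    with that[of s] show ?thesis by (simp add: algebra_simps)
  qed
qed

lemma C1_fun_on_shift:
  assumes "C1_fun_on UNIV f"
  shows "C1_fun_on UNIV (\<lambda>z. f (z + c))"
    and "dir_deriv v (\<lambda>z. f (z + c)) z = dir_deriv v f (z + c)"
proof -
  have D: "((\<lambda>z. f (z + c)) has_derivative (\<lambda>v. dir_deriv v f (z + c))) (at z)" for z
  proof (rule has_derivative_compose[where g = f])
    show "((\<lambda>z. z + c) has_derivative (\<lambda>v. v)) (at z)"
      by (auto intro!: derivative_eq_intros)
    show "(f has_derivative (\<lambda>v. dir_deriv v f (z + c))) (at (z + c))"
      using assms by (auto simp: C1_fun_on_def intro: has_derivative_dir_deriv)
  qed
  then show "dir_deriv v (\<lambda>z. f (z + c)) z = dir_deriv v f (z + c)"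
    by (rule dir_deriv_eq)
  show "C1_fun_on UNIV (\<lambda>z. f (z + c))"
  proof (rule C1_fun_onI[OF D])
    show "continuous_on UNIV (\<lambda>z. dir_deriv v f (z + c))" for v
      by (rule continuous_on_compose2[OF continuous_on_dir_deriv[OF assms]])
        (auto intro: continuous_intros)
  qed
qed

text \<open>Schwarz's theorem. The second difference \<open>D h\<close> is symmetric in
  \<open>a\<close> and \<open>b\<close>, and two mean values turn \<open>D h / h\<^sup>2\<close>
  into a mixed derivative near \<open>z\<close>, in either order. By continuity both mixed
  derivatives are the limit of the same sequence.\<close>

lemma dir_deriv_commute:
  assumes "C2_fun_on UNIV f"
  shows "dir_deriv a (dir_deriv b f) z = dir_deriv b (dir_deriv a f) z"
proof -
  define D where "D = (\<lambda>h. f (z + h *\<^sub>R a + h *\<^sub>R b) - f (z + h *\<^sub>R a) - f (z + h *\<^sub>R b) + f z)"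
  have main: "(\<lambda>k. D (1 / real (Suc k)) / (1 / real (Suc k))\<^sup>2) \<longlonglongrightarrow> dir_deriv q (dir_deriv p f) z"
    if pq: "(p, q) = (a, b) \<or> (p, q) = (b, a)" for p q
  proof -
    have "\<exists>s r. \<bar>s\<bar> \<le> h \<and> \<bar>r\<bar> \<le> h \<and> D h / h\<^sup>2 = dir_deriv q (dir_deriv p f) (z + s *\<^sub>R p + r *\<^sub>R q)"
      if h: "h > 0" for h
    proof -
      have f: "C1_fun_on UNIV f" and fp: "C1_fun_on UNIV (dir_deriv p f)"
        using assms by (auto simp: C2_fun_on_def)
      \<comment> \<open>\<open>D h\<close> is the first difference of \<open>g\<close> in direction
        \<open>p\<close>. One mean value is applied to \<open>g\<close>, the second to
        \<open>dir_deriv p f\<close> in direction \<open>q\<close>.\<close>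
      define g where "g = (\<lambda>w. f (w + h *\<^sub>R q) - f w)"
      have g: "C1_fun_on UNIV g"
        unfolding g_def by (intro C1_fun_on_diff C1_fun_on_shift f)
      have Dg: "dir_deriv p g w = dir_deriv p f (w + h *\<^sub>R q) - dir_deriv p f w" for w
        unfolding g_def using f C1_fun_on_shift(1)[OF f, of "h *\<^sub>R q"]
        by (subst dir_deriv_diff) (auto simp: C1_fun_on_imp_differentiable C1_fun_on_shift(2)[OF f])
      obtain s where s: "\<bar>s\<bar> \<le> \<bar>h\<bar>" "g (z + h *\<^sub>R p) - g z = h * dir_deriv p g (z + s *\<^sub>R p)"
        using h by (auto intro: mvt_dir_deriv[OF g, of h z p])
      obtain r where r: "\<bar>r\<bar> \<le> \<bar>h\<bar>" "dir_deriv p f (z + s *\<^sub>R p + h *\<^sub>R q) - dir_deriv p f (z + s *\<^sub>R p)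
          = h * dir_deriv q (dir_deriv p f) (z + s *\<^sub>R p + r *\<^sub>R q)"
        using h by (auto intro: mvt_dir_deriv[OF fp, of h "z + s *\<^sub>R p" q])
      have "D h = g (z + h *\<^sub>R p) - g z"
        using pq by (auto simp: D_def g_def algebra_simps)
      also have "\<dots> = h\<^sup>2 * dir_deriv q (dir_deriv p f) (z + s *\<^sub>R p + r *\<^sub>R q)"
        using s r by (simp add: Dg power2_eq_square)
      finally show ?thesis
        using s(1) r(1) h by (intro exI[of _ s] exI[of _ r]) auto
    qed
    then have "\<exists>s r. \<bar>s\<bar> \<le> 1 / real (Suc k) \<and> \<bar>r\<bar> \<le> 1 / real (Suc k) \<and>
        D (1 / real (Suc k)) / (1 / real (Suc k))\<^sup>2
          = dir_deriv q (dir_deriv p f) (z + s *\<^sub>R p + r *\<^sub>R q)" for k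
      by simp
    then obtain s r where sr: "\<And>k. \<bar>s k\<bar> \<le> 1 / real (Suc k)" "\<And>k. \<bar>r k\<bar> \<le> 1 / real (Suc k)"
      "\<And>k. D (1 / real (Suc k)) / (1 / real (Suc k))\<^sup>2
          = dir_deriv q (dir_deriv p f) (z + s k *\<^sub>R p + r k *\<^sub>R q)"
      by metis
    have "x \<longlonglongrightarrow> 0" if "\<And>k. \<bar>x k\<bar> \<le> 1 / real (Suc k)" for x :: "nat \<Rightarrow> real"
      by (rule Lim_null_comparison[OF _ LIMSEQ_inverse_real_of_nat])
        (simp add: that inverse_eq_divide del: of_nat_Suc)
    from this[OF sr(1)] this[OF sr(2)] have "s \<longlonglongrightarrow> 0" "r \<longlonglongrightarrow> 0" .
    then have "(\<lambda>k. z + s k *\<^sub>R p + r k *\<^sub>R q) \<longlonglongrightarrow> z + 0 *\<^sub>R p + 0 *\<^sub>R q"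
      by (intro tendsto_intros)
    moreover have "continuous_on UNIV (dir_deriv q (dir_deriv p f))"
      using assms by (simp add: C2_fun_on_def C1_fun_on_def)
    ultimately have "(\<lambda>k. dir_deriv q (dir_deriv p f) (z + s k *\<^sub>R p + r k *\<^sub>R q))
        \<longlonglongrightarrow> dir_deriv q (dir_deriv p f) z"
      using isCont_tendsto_compose[of z "dir_deriv q (dir_deriv p f)"]
      by (simp add: continuous_on_eq_continuous_at)
    then show ?thesis
      by (simp only: sr(3))
  qed
  show ?thesis
    using LIMSEQ_unique[OF main[of b a] main[of a b]] by simp
qed

section \<open>Integration by parts without third derivatives\<close>

lemma integral_translate:
  fixes f :: "'a::euclidean_space \<Rightarrow> real"
  assumes "f \<in> borel_measurable borel"
  shows "(\<integral>z. f (z + c) \<partial>lborel) = (\<integral>z. f z \<partial>lborel)"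
proof -
  have "(\<integral>z. f z \<partial>lborel) = (\<integral>z. f z \<partial>(distr lborel borel ((+) c)))"
    by (simp add: lborel_distr_plus)
  also have "\<dots> = (\<integral>z. f (c + z) \<partial>lborel)"
    using assms by (intro integral_distr) auto
  finally show ?thesis
    by (simp add: add.commute)
qed

lemma borel_measurable_C1_fun: "C1_fun_on UNIV f \<Longrightarrow> f \<in> borel_measurable borel"
  by (intro borel_measurable_continuous_onI C1_fun_on_imp_continuous)

text \<open>Dominated convergence: by the mean value theorem every difference quotient is bounded by
  \<open>M\<close>, so \<open>M * \<bar>w z\<bar>\<close> is a majorant. The steps
  \<open>h k\<close> may have either sign, since both signs occur in the swap below.\<close>

lemma tendsto_integral_difference_quotient:
  fixes F :: "'a::euclidean_space \<Rightarrow> real"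
  assumes F: "C1_fun_on UNIV F" and M: "\<And>z. \<bar>dir_deriv v F z\<bar> \<le> M"
    and w: "integrable lborel w"
    and h: "\<And>k::nat. h k \<noteq> 0" "h \<longlonglongrightarrow> 0"
  shows "(\<lambda>k. \<integral>z. w z * ((F (z + h k *\<^sub>R v) - F z) / h k) \<partial>lborel)
           \<longlonglongrightarrow> (\<integral>z. w z * dir_deriv v F z \<partial>lborel)"
proof (rule integral_dominated_convergence[where w = "\<lambda>z. M * \<bar>w z\<bar>"])
  have [measurable]: "F \<in> borel_measurable borel" "dir_deriv v F \<in> borel_measurable borel"
    by (intro borel_measurable_C1_fun borel_measurable_continuous_onI continuous_on_dir_deriv F)+
  have [measurable]: "w \<in> borel_measurable borel"
    using borel_measurable_integrable[OF w] by simp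
  show "(\<lambda>z. w z * dir_deriv v F z) \<in> borel_measurable lborel"
    "(\<lambda>z. w z * ((F (z + h k *\<^sub>R v) - F z) / h k)) \<in> borel_measurable lborel" for k
    by measurable
  show "integrable lborel (\<lambda>z. M * \<bar>w z\<bar>)"
    using w by simp
  show "AE z in lborel. (\<lambda>k. w z * ((F (z + h k *\<^sub>R v) - F z) / h k))
      \<longlonglongrightarrow> w z * dir_deriv v F z"
  proof (intro AE_I2 tendsto_mult tendsto_const)
    fix z
    have "(F has_derivative (\<lambda>v. dir_deriv v F z)) (at (z + 0 *\<^sub>R v))"
      using F by (auto simp: C1_fun_on_def intro: has_derivative_dir_deriv)
    from has_real_derivative_along_line[OF this]
    have "((\<lambda>s. (F (z + s *\<^sub>R v) - F z) / s) \<longlongrightarrow> dir_deriv v F z) (at 0)"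
      by (simp add: has_field_derivative_iff)
    moreover have "filterlim h (at 0) sequentially"
      using h by (simp add: filterlim_at)
    ultimately show "(\<lambda>k. (F (z + h k *\<^sub>R v) - F z) / h k) \<longlonglongrightarrow> dir_deriv v F z"
      by (rule filterlim_compose)
  qed
  show "AE z in lborel. norm (w z * ((F (z + h k *\<^sub>R v) - F z) / h k)) \<le> M * \<bar>w z\<bar>" for k
  proof (rule AE_I2)
    fix z
    obtain s where "F (z + h k *\<^sub>R v) - F z = h k * dir_deriv v F (z + s *\<^sub>R v)"
      by (rule mvt_dir_deriv[OF F h(1)[of k]])
    then have "(F (z + h k *\<^sub>R v) - F z) / h k = dir_deriv v F (z + s *\<^sub>R v)"
      using h(1)[of k] by simp
    then show "norm (w z * ((F (z + h k *\<^sub>R v) - F z) / h k)) \<le> M * \<bar>w z\<bar>"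
      using mult_left_mono[OF M[of "z + s *\<^sub>R v"], of "\<bar>w z\<bar>"]
      by (simp add: abs_mult mult.commute)
  qed
qed

text \<open>By translation invariance every difference quotient of \<open>H\<close> has integral 0,
  and the derivative is their limit under the integral.\<close>

lemma integral_dir_deriv_eq_0:
  fixes H :: "'a::euclidean_space \<Rightarrow> real"
  assumes H: "C1_fun_on UNIV H" "compactly_supported H"
  shows "(\<integral>z. dir_deriv v H z \<partial>lborel) = 0"
proof -
  obtain M where M: "\<And>z. \<bar>dir_deriv v H z\<bar> \<le> M"
    using compactly_supported_bounded[OF compactly_supported_dir_deriv[OF H(2)]
        continuous_on_dir_deriv[OF H(1)]] by metis
  obtain K where K: "compact K" "\<And>z. z \<notin> K \<Longrightarrow> H z = 0"
    using H(2) unfolding compactly_supported_def by auto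
  obtain R where R: "\<And>z. z \<in> K \<Longrightarrow> norm z \<le> R"
    using compact_imp_bounded[OF K(1)] by (auto simp: bounded_iff)
  \<comment> \<open>Since \<open>\<bar>h k\<bar> \<le> 1\<close>, all difference quotients of
    \<open>H\<close> vanish outside this ball. The weight therefore changes none of them, but it is
    integrable as dominated convergence requires.\<close>
  define w :: "'a \<Rightarrow> real" where "w = indicator (cball 0 (R + norm v))"
  have w: "integrable lborel w"
    unfolding w_def by (rule integrable_real_indicator[OF _ emeasure_bounded_finite]) auto
  define h where "h = (\<lambda>k. 1 / real (Suc k))"
  have h: "h k \<noteq> 0" "h \<longlonglongrightarrow> 0" "\<bar>h k\<bar> \<le> 1" for k
    using LIMSEQ_inverse_real_of_nat by (simp_all add: h_def inverse_eq_divide)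
  have wH: "w z * dir_deriv v H z = dir_deriv v H z" for z
  proof (cases "z \<in> K")
    case True
    then have "norm z \<le> R + norm v"
      using R[of z] norm_ge_zero[of v] by linarith
    then show ?thesis by (simp add: w_def)
  next
    case False
    then show ?thesis using dir_deriv_eq_0_outside[OF K] by simp
  qed
  have wq: "w z * ((H (z + h k *\<^sub>R v) - H z) / h k) = (H (z + h k *\<^sub>R v) - H z) / h k" for z k
  proof (cases "z \<in> cball 0 (R + norm v)")
    case False
    then have "z \<notin> K"
      using R[of z] norm_ge_zero[of v] by auto
    moreover have "z + h k *\<^sub>R v \<notin> K"
    proof
      assume "z + h k *\<^sub>R v \<in> K"
      then have "norm z \<le> R + norm (h k *\<^sub>R v)"
        using R[of "z + h k *\<^sub>R v"] norm_diff_ineq[of z "h k *\<^sub>R v"] by simp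
      also have "norm (h k *\<^sub>R v) \<le> norm v"
        using mult_right_mono[OF h(3)[of k], of "norm v"] by simp
      finally show False
        using False by simp
    qed
    ultimately show ?thesis by (simp add: K(2))
  qed (simp add: w_def)
  have H_int: "integrable lborel H"
    using H by (intro integrable_compactly_supported C1_fun_on_imp_continuous)
  have shift_int: "integrable lborel (\<lambda>z. H (z + c))" for c
  proof (rule integrable_compactly_supported)
    show "compactly_supported (\<lambda>z. H (z + c))"
      unfolding compactly_supported_def
      by (rule exI[of _ "(\<lambda>z. z - c) ` K"])
        (auto simp: image_iff K algebra_simps intro!: compact_continuous_image continuous_intros
          intro: K(2))
    show "continuous_on UNIV (\<lambda>z. H (z + c))"
      by (intro C1_fun_on_imp_continuous C1_fun_on_shift H)
  qed
  have "(\<integral>z. (H (z + h k *\<^sub>R v) - H z) / h k \<partial>lborel) = 0" for k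
    by (simp add: Bochner_Integration.integral_diff[OF shift_int H_int]
        integral_translate[OF borel_measurable_C1_fun[OF H(1)]])
  with tendsto_integral_difference_quotient[OF H(1) M w h(1,2)] show ?thesis
    unfolding wH wq by (simp only: LIMSEQ_const_iff)
qed

text \<open>For smooth functions two integrations by parts would do. Here
  \<open>dir_deriv b G\<close> is first replaced by a difference quotient of \<open>G\<close>; the
  derivative along \<open>a\<close> is moved by parts, the difference is moved by translation, and
  the step size then tends to 0.\<close>

lemma integral_dir_deriv_swap:
  fixes F G :: "'a::euclidean_space \<Rightarrow> real"
  assumes F: "C1_fun_on UNIV F" "compactly_supported F"
    and G: "C1_fun_on UNIV G" "compactly_supported G"
  shows "(\<integral>z. dir_deriv a F z * dir_deriv b G z \<partial>lborel)
       = (\<integral>z. dir_deriv b F z * dir_deriv a G z \<partial>lborel)"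
proof -
  have intD: "integrable lborel (dir_deriv a F)" "integrable lborel (dir_deriv a G)"
    using F G by (auto intro!: integrable_compactly_supported compactly_supported_dir_deriv
        continuous_on_dir_deriv)
  obtain MF where MF: "\<And>z. \<bar>dir_deriv b F z\<bar> \<le> MF"
    using compactly_supported_bounded[OF compactly_supported_dir_deriv[OF F(2)]
        continuous_on_dir_deriv[OF F(1)]] by metis
  obtain MG where MG: "\<And>z. \<bar>dir_deriv b G z\<bar> \<le> MG"
    using compactly_supported_bounded[OF compactly_supported_dir_deriv[OF G(2)]
        continuous_on_dir_deriv[OF G(1)]] by metis
  define h where "h = (\<lambda>k. 1 / real (Suc k))"
  have h: "h k \<noteq> 0" "h \<longlonglongrightarrow> 0" for k
    using LIMSEQ_inverse_real_of_nat by (simp_all add: h_def inverse_eq_divide)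
  have "(\<integral>z. dir_deriv a F z * ((G (z + h k *\<^sub>R b) - G z) / h k) \<partial>lborel)
      = (\<integral>z. dir_deriv a G z * ((F (z + (- h k) *\<^sub>R b) - F z) / (- h k)) \<partial>lborel)" for k
  proof -
    \<comment> \<open>As a combination of translates of \<open>G\<close>, the quotient is again
      continuously differentiable, which its limit \<open>dir_deriv b G\<close> need not be.\<close>
    define Q where "Q = (\<lambda>z. (1 / h k) * (G (z + h k *\<^sub>R b) - G z))"
    have Q: "C1_fun_on UNIV Q"
      unfolding Q_def by (intro C1_fun_on_cmult C1_fun_on_diff C1_fun_on_shift G)
    have DQ: "dir_deriv a Q z = (1 / h k) * (dir_deriv a G (z + h k *\<^sub>R b) - dir_deriv a G z)" for z
      unfolding Q_def using G C1_fun_on_shift(1)[OF G(1), of "h k *\<^sub>R b"]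
      by (subst dir_deriv_mult)
        (auto simp: dir_deriv_const dir_deriv_diff C1_fun_on_imp_differentiable
           C1_fun_on_shift(2)[OF G(1)])
    have c: "continuous_on UNIV F" "continuous_on UNIV Q" "continuous_on UNIV (dir_deriv a F)"
      "continuous_on UNIV (dir_deriv a Q)" "continuous_on UNIV (dir_deriv a G)"
      "continuous_on UNIV (\<lambda>z. dir_deriv a G (z + h k *\<^sub>R b))"
      using F Q G C1_fun_on_shift(1)[OF G(1), of "h k *\<^sub>R b", THEN continuous_on_dir_deriv, of a]
      by (auto simp: C1_fun_on_imp_continuous continuous_on_dir_deriv
          C1_fun_on_shift(2)[OF G(1)] cong: continuous_on_cong)
    have i1: "integrable lborel (\<lambda>z. F z * dir_deriv a Q z)"
      and i2: "integrable lborel (\<lambda>z. dir_deriv a F z * Q z)"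
      and i3: "integrable lborel (\<lambda>z. F z * dir_deriv a G (z + h k *\<^sub>R b))"
      and i4: "integrable lborel (\<lambda>z. F z * dir_deriv a G z)"
      using F c by (auto intro!: integrable_compactly_supported compactly_supported_mult(1)
          compactly_supported_dir_deriv continuous_intros)
    have i5: "integrable lborel (\<lambda>z. F (z + (- h k) *\<^sub>R b) * dir_deriv a G z)"
      using F G c C1_fun_on_imp_continuous[OF C1_fun_on_shift(1)[OF F(1), of "(- h k) *\<^sub>R b"]]
      by (auto intro!: integrable_compactly_supported compactly_supported_mult(2)
          compactly_supported_dir_deriv continuous_on_mult)
    have "0 = (\<integral>z. dir_deriv a (\<lambda>z. F z * Q z) z \<partial>lborel)"
      using F Q by (intro integral_dir_deriv_eq_0[symmetric] C1_fun_on_mult compactly_supported_mult(1))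
    also have "\<dots> = (\<integral>z. F z * dir_deriv a Q z + dir_deriv a F z * Q z \<partial>lborel)"
      using F Q by (simp add: dir_deriv_mult C1_fun_on_imp_differentiable)
    also have "\<dots> = (\<integral>z. F z * dir_deriv a Q z \<partial>lborel) + (\<integral>z. dir_deriv a F z * Q z \<partial>lborel)"
      by (rule Bochner_Integration.integral_add[OF i1 i2])
    finally have e1: "(\<integral>z. dir_deriv a F z * Q z \<partial>lborel) = - (\<integral>z. F z * dir_deriv a Q z \<partial>lborel)"
      by simp
    \<comment> \<open>The translation by \<open>- h k\<close> along \<open>b\<close> takes the shift
      off \<open>G\<close> and puts it on \<open>F\<close>; hence the quotient of \<open>F\<close>
      has step \<open>- h k\<close>.\<close>
    have "(\<integral>z. F z * dir_deriv a G (z + h k *\<^sub>R b) \<partial>lborel)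
        = (\<integral>z. F (z + (- h k) *\<^sub>R b) * dir_deriv a G (z + (- h k) *\<^sub>R b + h k *\<^sub>R b) \<partial>lborel)"
      using c by (intro integral_translate[symmetric] borel_measurable_continuous_onI continuous_on_mult)
    then have e2: "(\<integral>z. F z * dir_deriv a G (z + h k *\<^sub>R b) \<partial>lborel)
        = (\<integral>z. F (z + (- h k) *\<^sub>R b) * dir_deriv a G z \<partial>lborel)"
      by simp
    have "(\<integral>z. F z * dir_deriv a Q z \<partial>lborel)
        = (\<integral>z. (1 / h k) * (F z * dir_deriv a G (z + h k *\<^sub>R b) - F z * dir_deriv a G z) \<partial>lborel)"
      by (simp add: DQ algebra_simps)
    also have "\<dots> = (1 / h k) * ((\<integral>z. F (z + (- h k) *\<^sub>R b) * dir_deriv a G z \<partial>lborel)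
        - (\<integral>z. F z * dir_deriv a G z \<partial>lborel))"
      using i3 i4 e2 by (simp add: Bochner_Integration.integral_diff)
    also have "\<dots> = (1 / h k) *
        (\<integral>z. F (z + (- h k) *\<^sub>R b) * dir_deriv a G z - F z * dir_deriv a G z \<partial>lborel)"
      by (subst Bochner_Integration.integral_diff[OF i5 i4]) simp
    also have "\<dots> = (\<integral>z. (1 / h k) *
        (F (z + (- h k) *\<^sub>R b) * dir_deriv a G z - F z * dir_deriv a G z) \<partial>lborel)"
      by simp
    finally have "(\<integral>z. dir_deriv a F z * Q z \<partial>lborel) = (\<integral>z. - ((1 / h k) *
        (F (z + (- h k) *\<^sub>R b) * dir_deriv a G z - F z * dir_deriv a G z)) \<partial>lborel)"
      using e1 by simp
    also have "\<dots> = (\<integral>z. dir_deriv a G z * ((F (z + (- h k) *\<^sub>R b) - F z) / (- h k)) \<partial>lborel)"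
      by (rule Bochner_Integration.integral_cong) (auto simp: field_simps h(1))
    finally show ?thesis
      by (simp add: Q_def)
  qed
  moreover have "(\<lambda>k. \<integral>z. dir_deriv a F z * ((G (z + h k *\<^sub>R b) - G z) / h k) \<partial>lborel)
      \<longlonglongrightarrow> (\<integral>z. dir_deriv a F z * dir_deriv b G z \<partial>lborel)"
    by (rule tendsto_integral_difference_quotient[OF G(1) MG intD(1) h])
  moreover have "(\<lambda>k. \<integral>z. dir_deriv a G z * ((F (z + (- h k) *\<^sub>R b) - F z) / (- h k)) \<partial>lborel)
      \<longlonglongrightarrow> (\<integral>z. dir_deriv a G z * dir_deriv b F z \<partial>lborel)"
    by (rule tendsto_integral_difference_quotient[OF F(1) MF intD(2)])
      (use h tendsto_minus[OF h(2)] in auto)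
  ultimately have "(\<integral>z. dir_deriv a F z * dir_deriv b G z \<partial>lborel)
      = (\<integral>z. dir_deriv a G z * dir_deriv b F z \<partial>lborel)"
    using LIMSEQ_unique by simp
  then show ?thesis
    by (simp add: mult.commute)
qed

section \<open>Cutoff functions\<close>

lemma C2_bump:
  fixes a :: "'a::euclidean_space"
  shows "C2_fun_on UNIV (\<lambda>z. (max 0 (r\<^sup>2 - (z - a) \<bullet> (z - a))) ^ 3)"
proof (rule C2_fun_on_max_0_cube)
  show "C2_fun_on UNIV (\<lambda>z. r\<^sup>2 - (z - a) \<bullet> (z - a))"
  proof (rule C2_fun_onI)
    show "((\<lambda>z. r\<^sup>2 - (z - a) \<bullet> (z - a)) has_derivative (\<lambda>v. - 2 * ((z - a) \<bullet> v))) (at z)" for z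
      by (auto intro!: derivative_eq_intros simp: inner_commute)
    show "C1_fun_on UNIV (\<lambda>z. - 2 * ((z - a) \<bullet> v))" for v
    proof (rule C1_fun_onI)
      show "((\<lambda>z. - 2 * ((z - a) \<bullet> v)) has_derivative (\<lambda>w. - 2 * (w \<bullet> v))) (at z)" for z
        by (auto intro!: derivative_eq_intros)
    qed auto
  qed simp
qed simp

lemma bump_pos_iff:
  fixes a z :: "'a::euclidean_space"
  assumes "r > 0"
  shows "(max 0 (r\<^sup>2 - (z - a) \<bullet> (z - a))) ^ 3 > 0 \<longleftrightarrow> z \<in> ball a r"
proof -
  have "(z - a) \<bullet> (z - a) < r\<^sup>2 \<longleftrightarrow> dist a z < r"
    using assms by (metis abs_of_pos dist_commute dist_norm norm_ge_zero power2_norm_eq_inner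
        power2_less_imp_less power_strict_mono less_imp_le zero_less_numeral)
  then show ?thesis
    by (auto simp: max_def)
qed

text \<open>Finitely many bumps on balls inside \<open>S\<close> have a sum \<open>w\<close> that is
  positive on \<open>K\<close>, and a truncation of \<open>w\<close> gives the cutoff. It equals 1
  on an open neighbourhood of \<open>K\<close>, so that multiplying by it leaves derivatives on
  \<open>K\<close> unchanged.\<close>

lemma C2_cutoff:
  fixes K S :: "'a::euclidean_space set"
  assumes "compact K" "open S" "K \<subseteq> S"
  obtains \<psi> L U where "C2_fun_on UNIV \<psi>" "compact L" "L \<subseteq> S" "\<And>z. z \<notin> L \<Longrightarrow> \<psi> z = 0"
    "open U" "K \<subseteq> U" "\<And>z. z \<in> U \<Longrightarrow> \<psi> z = 1"
proof (cases "K = {}")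
  case True
  show ?thesis
    by (rule that[of "\<lambda>z. 0" "{}" "{}"]) (auto simp: True intro: C2_fun_on_const)
next
  case False
  have "\<exists>r>0. cball a r \<subseteq> S" if "a \<in> K" for a
    using that assms open_contains_cball by blast
  then obtain r where r: "\<And>a. a \<in> K \<Longrightarrow> r a > 0" "\<And>a. a \<in> K \<Longrightarrow> cball a (r a) \<subseteq> S"
    by metis
  have "K \<subseteq> (\<Union>a\<in>K. ball a (r a))"
    using r(1) by (auto intro!: bexI)
  then obtain A where A: "A \<subseteq> K" "finite A" "K \<subseteq> (\<Union>a\<in>A. ball a (r a))"
    using compactE_image[OF assms(1), of K "\<lambda>a. ball a (r a)"] by auto
  define b where "b = (\<lambda>a z. (max 0 ((r a)\<^sup>2 - (z - a) \<bullet> (z - a))) ^ 3)"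
  define w where "w = (\<lambda>z. \<Sum>a\<in>A. b a z)"
  have b_nonneg: "b a z \<ge> 0" for a z
    by (simp add: b_def)
  have b_pos: "b a z > 0 \<longleftrightarrow> z \<in> ball a (r a)" if "a \<in> A" for a z
    unfolding b_def by (rule bump_pos_iff) (use that A r in auto)
  have w: "C2_fun_on UNIV w"
    unfolding w_def b_def by (intro C2_fun_on_sum C2_bump A) simp
  then have w_cont: "continuous_on UNIV w"
    by (intro C1_fun_on_imp_continuous C2_fun_on_imp_C1)
  have w_pos: "w z > 0" if "z \<in> K" for z
  proof -
    obtain a where "a \<in> A" "z \<in> ball a (r a)"
      using A(3) \<open>z \<in> K\<close> by blast
    then show ?thesis
      unfolding w_def using A(2) b_pos b_nonneg by (intro sum_pos2) auto
  qed
  obtain z0 where z0: "z0 \<in> K" "\<And>z. z \<in> K \<Longrightarrow> w z0 \<le> w z"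
    using continuous_attains_inf[OF assms(1) False continuous_on_subset[OF w_cont]] by auto
  define c where "c = w z0"
  have c: "c > 0"
    using w_pos z0 by (simp add: c_def)
  \<comment> \<open>Where \<open>w z = 0\<close> the value is \<open>1 - 1 = 0\<close>. Where
    \<open>w z > c / 2\<close> the positive part vanishes and the value is 1. On \<open>K\<close>
    even \<open>w z \<ge> c\<close> holds.\<close>
  define \<psi> where "\<psi> = (\<lambda>z. 1 + (-1) * (max 0 (1 + (- 2 / c) * w z)) ^ 3)"
  show ?thesis
  proof (rule that)
    show "C2_fun_on UNIV \<psi>"
      unfolding \<psi>_def
      by (intro C2_fun_on_add C2_fun_on_const C2_fun_on_mult C2_fun_on_max_0_cube w open_UNIV)
    show "compact (\<Union>a\<in>A. cball a (r a))"
      using A(2) by (intro compact_UN) auto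
    show "(\<Union>a\<in>A. cball a (r a)) \<subseteq> S"
      using A(1) r(2) by auto
    show "\<psi> z = 0" if "z \<notin> (\<Union>a\<in>A. cball a (r a))" for z
    proof -
      have "b a z = 0" if "a \<in> A" for a
        using b_pos[OF that, of z] b_nonneg[of a z] that \<open>z \<notin> _\<close> by force
      then show ?thesis
        by (simp add: \<psi>_def w_def)
    qed
    show "open {z. w z > c / 2}"
      using w_cont by (intro open_Collect_less) auto
    show "K \<subseteq> {z. w z > c / 2}"
      using z0 c by (force simp: c_def)
    show "\<psi> z = 1" if "z \<in> {z. w z > c / 2}" for z
      using that c by (simp add: \<psi>_def field_simps max_def)
  qed
qed

section \<open>Calculus of the Heisenberg fields\<close>

text \<open>Together with \<open>hcoef\<close>, splits \<open>X i\<close> into a derivative in a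
  constant direction and a linear coefficient times \<open>dt\<close>, so that both families of
  fields are treated alike.\<close>

definition hdir :: "'n + 'n \<Rightarrow> 'n::finite heisenberg" where
  "hdir i = (case i of Inl j \<Rightarrow> (axis j 1, 0, 0) | Inr j \<Rightarrow> (0, axis j 1, 0))"

definition hcoef :: "'n + 'n \<Rightarrow> 'n::finite heisenberg \<Rightarrow> real" where
  "hcoef i z = (case i of Inl j \<Rightarrow> 2 * fst (snd z) $ j | Inr j \<Rightarrow> - 2 * fst z $ j)"

text \<open>The structure constants: \<open>[X i, X j] = - 4 * sform i j * dt\<close>.\<close>

definition sform :: "'n + 'n \<Rightarrow> 'n + 'n \<Rightarrow> real" where
  "sform i j = (case (i, j) of
      (Inl a, Inr b) \<Rightarrow> (if a = b then 1 else 0)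
    | (Inr a, Inl b) \<Rightarrow> (if a = b then - 1 else 0)
    | _ \<Rightarrow> 0)"

lemma X_eq: "X i u z = dir_deriv (hdir i) u z + hcoef i z * dt u z"
  by (cases z; cases i) (auto simp: dx_def dy_def hdir_def hcoef_def)

lemma sform_antisym: "sform j i = - sform i j"
  by (cases i; cases j) (auto simp: sform_def)

text \<open>As \<open>hcoef j\<close> is linear, this is its derivative along \<open>hdir i\<close>;
  the commutators of the fields arise from it.\<close>

lemma hcoef_hdir: "hcoef j (hdir i) = - 2 * sform i j"
  by (cases i; cases j) (auto simp: sform_def hcoef_def hdir_def axis_def)

lemma hcoef_dt: "hcoef j (0, 0, 1) = 0"
  by (cases j) (auto simp: hcoef_def)

lemma bounded_linear_hcoef: "bounded_linear (hcoef i)"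
proof (cases i)
  case (Inl a)
  have "bounded_linear (\<lambda>z :: 'a heisenberg. 2 *\<^sub>R (fst (snd z) $ a))"
    by (intro bounded_linear_compose[OF bounded_linear_scaleR_right]
        bounded_linear_compose[OF bounded_linear_vec_nth]
        bounded_linear_compose[OF bounded_linear_fst] bounded_linear_snd)
  then show ?thesis
    by (simp add: Inl hcoef_def[abs_def])
next
  case (Inr a)
  have "bounded_linear (\<lambda>z :: 'a heisenberg. (- 2) *\<^sub>R (fst z $ a))"
    by (intro bounded_linear_compose[OF bounded_linear_scaleR_right]
        bounded_linear_compose[OF bounded_linear_vec_nth] bounded_linear_fst)
  then show ?thesis
    by (simp add: Inr hcoef_def[abs_def])
qed

lemma sum_UNIV_sum:
  fixes f :: "'a::finite + 'b::finite \<Rightarrow> real"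
  shows "(\<Sum>i\<in>UNIV. f i) = (\<Sum>a\<in>UNIV. f (Inl a)) + (\<Sum>b\<in>UNIV. f (Inr b))"
  by (subst UNIV_Plus_UNIV[symmetric], subst sum.Plus) (auto simp: o_def)

text \<open>Every row of the standard symplectic matrix has exactly one nonzero entry, which is 1 or
  -1. Summed over all \<open>2n\<close> rows this puts the dimension into the constants
  below.\<close>

lemma sum_sform_sq: "(\<Sum>j\<in>UNIV. (sform i j)\<^sup>2) = 1" for i :: "'n::finite + 'n"
proof (cases i)
  case (Inl a)
  have "(sform i (Inr b))\<^sup>2 = (if b = a then 1 else 0)" for b
    by (auto simp: Inl sform_def)
  then show ?thesis by (simp add: sum_UNIV_sum) (simp add: Inl sform_def)
next
  case (Inr a)
  have "(sform i (Inl b))\<^sup>2 = (if b = a then 1 else 0)" for b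
    by (auto simp: Inr sform_def)
  then show ?thesis by (simp add: sum_UNIV_sum) (simp add: Inr sform_def)
qed

lemma C1_fun_on_dt: "C2_fun_on S u \<Longrightarrow> C1_fun_on S (dt u)"
  unfolding dt_def by (rule C1_fun_on_dir_deriv)

lemma C1_fun_on_X:
  assumes "C2_fun_on S u"
  shows "C1_fun_on S (X i u)"
proof -
  have "X i u = (\<lambda>z. dir_deriv (hdir i) u z + hcoef i z * dt u z)"
    by (simp add: fun_eq_iff X_eq)
  then show ?thesis
    using assms by (simp add: C1_fun_on_add C1_fun_on_mult C1_fun_on_dir_deriv C1_fun_on_dt
        C1_fun_on_bounded_linear bounded_linear_hcoef)
qed

lemma continuous_on_dt: "C1_fun_on S f \<Longrightarrow> continuous_on S (dt f)"
  unfolding dt_def by (rule continuous_on_dir_deriv)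

lemma continuous_on_X:
  assumes "C1_fun_on S f"
  shows "continuous_on S (X i f)"
proof -
  have "continuous_on S (hcoef i)"
    by (intro linear_continuous_on bounded_linear_hcoef)
  with assms show ?thesis
    by (subst continuous_on_cong[OF refl X_eq])
      (intro continuous_intros continuous_on_dir_deriv continuous_on_dt)
qed

lemma compactly_supported_dt: "compactly_supported f \<Longrightarrow> compactly_supported (dt f)"
  unfolding dt_def by (rule compactly_supported_dir_deriv)

lemma compactly_supported_X:
  assumes "compactly_supported f"
  shows "compactly_supported (X i f)"
proof -
  have "X i f = (\<lambda>z. dir_deriv (hdir i) f z + hcoef i z * dt f z)"
    by (simp add: fun_eq_iff X_eq)
  then show ?thesis
    using assms by (simp add: compactly_supported_add compactly_supported_mult
        compactly_supported_dir_deriv compactly_supported_dt)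
qed

lemma X_cong:
  assumes "open S" "z \<in> S" "\<And>w. w \<in> S \<Longrightarrow> f w = g w"
  shows "X i f z = X i g z"
  unfolding X_eq dt_def by (simp add: dir_deriv_cong[OF assms])

lemma dt_cong:
  assumes "open S" "z \<in> S" "\<And>w. w \<in> S \<Longrightarrow> f w = g w"
  shows "dt f z = dt g z"
  unfolding dt_def by (rule dir_deriv_cong[OF assms])

lemma heis_hessian_cong:
  assumes "open S" "z \<in> S" "\<And>w. w \<in> S \<Longrightarrow> f w = g w"
  shows "heis_hessian f z = heis_hessian g z"
proof -
  have "X i (X j f) z = X i (X j g) z" for i j
    by (rule X_cong[OF assms(1,2)]) (rule X_cong[OF assms(1) _ assms(3)])
  then show ?thesis
    by (simp add: heis_hessian_def)
qed

section \<open>Product rule, commutators and integration by parts for the fields\<close>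

lemma X_mult:
  assumes "f differentiable (at z)" "g differentiable (at z)"
  shows "X i (\<lambda>z. f z * g z) z = f z * X i g z + X i f z * g z"
  by (simp add: X_eq dt_def dir_deriv_mult[OF assms] algebra_simps)

lemma dir_deriv_hcoef: "dir_deriv v (hcoef i) z = hcoef i v"
  by (rule dir_deriv_bounded_linear) (rule bounded_linear_hcoef)

lemma hcoef_differentiable: "hcoef i differentiable (at z)"
  using bounded_linear_hcoef bounded_linear_imp_differentiable by blast

lemma dir_deriv_X:
  assumes "C2_fun_on UNIV u"
  shows "dir_deriv v (X j u) z = dir_deriv v (dir_deriv (hdir j) u) z
    + hcoef j z * dir_deriv v (dt u) z + hcoef j v * dt u z"
proof -
  have d: "dir_deriv w u differentiable (at z)" for w
    by (rule C1_fun_on_imp_differentiable[OF C1_fun_on_dir_deriv[OF assms] UNIV_I])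
  have "X j u = (\<lambda>z. dir_deriv (hdir j) u z + hcoef j z * dt u z)"
    by (simp add: fun_eq_iff X_eq)
  then show ?thesis
    using d by (simp add: dir_deriv_add dir_deriv_mult dt_def hcoef_differentiable dir_deriv_hcoef
        differentiable_mult)
qed

text \<open>The coefficients of \<open>X j\<close> do not depend on the variable t.\<close>

lemma dt_X:
  assumes "C2_fun_on UNIV u"
  shows "dt (X j u) z = X j (dt u) z"
  using dir_deriv_X[OF assms, of "(0, 0, 1)" j z]
    dir_deriv_commute[OF assms, of "(0, 0, 1)" "hdir j" z]
  by (simp add: hcoef_dt X_eq dt_def)

text \<open>Second-order directional derivatives cancel by symmetry. What survives is
  \<open>hcoef j (hdir i) - hcoef i (hdir j)\<close>, which is \<open>- 4 * sform i j\<close> by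
  antisymmetry.\<close>

lemma X_X_commute:
  assumes "C2_fun_on UNIV u"
  shows "X i (X j u) z = X j (X i u) z - 4 * sform i j * dt u z"
proof -
  have "dir_deriv v (dt u) z = dt (dir_deriv v u) z" for v
    unfolding dt_def by (rule dir_deriv_commute[OF assms])
  then show ?thesis
    using dir_deriv_commute[OF assms, of "hdir i" "hdir j" z] sform_antisym[of j i]
    unfolding X_eq[of i "X j u"] X_eq[of j "X i u"] dt_X[OF assms]
    by (simp add: dir_deriv_X[OF assms] X_eq hcoef_hdir algebra_simps)
qed

text \<open>\<open>X i\<close> is divergence free: \<open>hcoef i\<close> is constant in t, so it
  can be moved under \<open>dt\<close>. Using \<open>has_bochner_integral\<close> keeps
  integrability at hand when identities are added up.\<close>

lemma has_bochner_integral_X: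
  assumes H: "C1_fun_on UNIV H" "compactly_supported H"
  shows "has_bochner_integral lborel (X i H) 0"
proof -
  have eq: "X i H z = dir_deriv (hdir i) H z + dt (\<lambda>z. hcoef i z * H z) z" for z
    using H(1) by (simp add: X_eq dt_def dir_deriv_mult hcoef_differentiable dir_deriv_hcoef
        hcoef_dt C1_fun_on_imp_differentiable)
  have c: "C1_fun_on UNIV (\<lambda>z. hcoef i z * H z)" "compactly_supported (\<lambda>z. hcoef i z * H z)"
    using H by (auto intro!: C1_fun_on_mult C1_fun_on_bounded_linear[OF bounded_linear_hcoef]
        compactly_supported_mult)
  have "has_bochner_integral lborel (dir_deriv v F) 0"
    if "C1_fun_on UNIV F" "compactly_supported F" for v and F :: "'a heisenberg \<Rightarrow> real"
    using that integral_dir_deriv_eq_0[OF that] by (simp add: has_bochner_integral_iff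
        integrable_compactly_supported compactly_supported_dir_deriv continuous_on_dir_deriv)
  from has_bochner_integral_add[OF this[OF H] this[OF c]] show ?thesis
    by (simp add: eq[abs_def] dt_def)
qed

text \<open>The analogue of the swap for the noncommuting fields. The correction involving
  \<open>dt G\<close> comes from derivatives falling on the coefficients.\<close>

lemma has_bochner_integral_X_swap:
  assumes F: "C1_fun_on UNIV F" "compactly_supported F"
    and G: "C1_fun_on UNIV G" "compactly_supported G"
  shows "has_bochner_integral lborel
    (\<lambda>z. X i F z * X j G z - X j F z * X i G z - 4 * sform i j * (F z * dt G z)) 0"
proof -
  have swap: "has_bochner_integral lborel
      (\<lambda>z. dir_deriv a H z * dir_deriv b G z - dir_deriv b H z * dir_deriv a G z) 0"
    if H: "C1_fun_on UNIV H" "compactly_supported H" for a b and H :: "'a heisenberg \<Rightarrow> real"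
  proof -
    have "integrable lborel (\<lambda>z. dir_deriv a H z * dir_deriv b G z)" for a b
      using H G by (intro integrable_compactly_supported compactly_supported_mult(1)
          compactly_supported_dir_deriv continuous_on_mult continuous_on_dir_deriv)
    then show ?thesis
      by (simp add: has_bochner_integral_iff integral_dir_deriv_swap[OF H G, of a b])
  qed
  have c: "C1_fun_on UNIV (\<lambda>z. hcoef k z * F z)" "compactly_supported (\<lambda>z. hcoef k z * F z)" for k
    using F by (auto intro!: C1_fun_on_mult C1_fun_on_bounded_linear[OF bounded_linear_hcoef]
        compactly_supported_mult)
  have D: "dir_deriv v (\<lambda>z. hcoef k z * F z) z = hcoef k z * dir_deriv v F z + hcoef k v * F z" for k v z
    using F(1) by (simp add: dir_deriv_mult hcoef_differentiable dir_deriv_hcoef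
        C1_fun_on_imp_differentiable)
  \<comment> \<open>Three instances of the swap for constant directions: one for \<open>F\<close>,
    one for \<open>hcoef j * F\<close>, one for \<open>hcoef i * F\<close>. The products of two
    \<open>dt\<close> derivatives cancel, and each of the last two brackets contributes
    \<open>- 2 * sform i j * (F z * dt G z)\<close>.\<close>
  have "X i F z * X j G z - X j F z * X i G z - 4 * sform i j * (F z * dt G z) =
      (dir_deriv (hdir i) F z * dir_deriv (hdir j) G z - dir_deriv (hdir j) F z * dir_deriv (hdir i) G z)
      + (dir_deriv (hdir i) (\<lambda>z. hcoef j z * F z) z * dir_deriv (0, 0, 1) G z
         - dir_deriv (0, 0, 1) (\<lambda>z. hcoef j z * F z) z * dir_deriv (hdir i) G z)
      + (dir_deriv (0, 0, 1) (\<lambda>z. hcoef i z * F z) z * dir_deriv (hdir j) G z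
         - dir_deriv (hdir j) (\<lambda>z. hcoef i z * F z) z * dir_deriv (0, 0, 1) G z)" for z
    using sform_antisym[of j i]
    unfolding D X_eq dt_def hcoef_hdir hcoef_dt by (simp add: algebra_simps)
  then show ?thesis
    using has_bochner_integral_add[OF has_bochner_integral_add[OF swap[OF F, of "hdir i" "hdir j"]
        swap[OF c, of "hdir i" j "(0, 0, 1)"]] swap[OF c, of "(0, 0, 1)" i "hdir j"]]
    by simp
qed

section \<open>The integral identity for \<open>sigma2\<close>\<close>

lemma two_sigma2_heis_hessian:
  fixes u :: "'n::finite heisenberg \<Rightarrow> real"
  assumes "C2_fun_on UNIV u"
  shows "2 * sigma2 (heis_hessian u z) =
    (\<Sum>i\<in>UNIV. \<Sum>j\<in>UNIV. X i (X i u) z * X j (X j u) z - X j (X i u) z * X i (X j u) z)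
    - 8 * real CARD('n) * (dt u z)\<^sup>2"
proof -
  define A where "A = heis_hessian u z"
  have "transpose A = A"
    by (simp add: A_def heis_hessian_def transpose_def add.commute)
  \<comment> \<open>The square of the mean of two numbers is their product plus the square of half
    their difference; here half the difference is \<open>2 * sform i j * dt u z\<close> up to
    sign.\<close>
  have entries: "A $ i $ i * A $ j $ j - (A $ i $ j)\<^sup>2 =
      (X i (X i u) z * X j (X j u) z - X j (X i u) z * X i (X j u) z)
      - 4 * (sform i j)\<^sup>2 * (dt u z)\<^sup>2" for i j
    by (simp add: A_def heis_hessian_def X_X_commute[OF assms, of i j] power2_eq_square field_simps)
  from \<open>transpose A = A\<close> have "2 * sigma2 A = (\<Sum>(i, j) | i \<noteq> j. A $ i $ i * A $ j $ j - (A $ i $ j)\<^sup>2)"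
    by (simp add: sigma2_eq_half_sum)
  also have "\<dots> = (\<Sum>(i, j)\<in>UNIV. A $ i $ i * A $ j $ j - (A $ i $ j)\<^sup>2)"
    by (rule sum.mono_neutral_left) (auto simp: power2_eq_square)
  also have "\<dots> = (\<Sum>i\<in>UNIV. \<Sum>j\<in>UNIV. A $ i $ i * A $ j $ j - (A $ i $ j)\<^sup>2)"
    by (simp add: sum.cartesian_product)
  also have "\<dots> = (\<Sum>i\<in>UNIV. \<Sum>j\<in>UNIV.
      (X i (X i u) z * X j (X j u) z - X j (X i u) z * X i (X j u) z)
      - 4 * (sform i j)\<^sup>2 * (dt u z)\<^sup>2)"
    by (intro sum.cong refl entries)
  also have "\<dots> = (\<Sum>i\<in>UNIV. \<Sum>j\<in>UNIV.
      X i (X i u) z * X j (X j u) z - X j (X i u) z * X i (X j u) z)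
      - 4 * (\<Sum>i\<in>(UNIV :: ('n + 'n) set). \<Sum>j\<in>UNIV. (sform i j)\<^sup>2) * (dt u z)\<^sup>2"
    by (simp add: sum_subtractf sum_distrib_left sum_distrib_right)
  finally show ?thesis
    by (simp add: A_def sum_sform_sq)
qed

text \<open>Contraction with an antisymmetric matrix sees only the commutators: swapping the indices
  shows that twice the sum is \<open>4 * dt u z\<close> times the \<open>2n\<close> from
  \<open>sum_sform_sq\<close>.\<close>

lemma sum_sform_X_X:
  fixes u :: "'n::finite heisenberg \<Rightarrow> real"
  assumes "C2_fun_on UNIV u"
  shows "(\<Sum>i\<in>UNIV. \<Sum>j\<in>UNIV. sform i j * X j (X i u) z) = 4 * real CARD('n) * dt u z"
proof -
  let ?A = "\<Sum>i\<in>UNIV. \<Sum>j\<in>UNIV. sform i j * X j (X i u) z"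
  have swapped: "sform j i * X i (X j u) z = 4 * dt u z * (sform i j)\<^sup>2 - sform i j * X j (X i u) z"
    for i j
    by (simp add: X_X_commute[OF assms, of i j] sform_antisym[of j i] power2_eq_square
        algebra_simps)
  have "?A = (\<Sum>i\<in>UNIV. \<Sum>j\<in>UNIV. sform j i * X i (X j u) z)"
    by (rule sum.swap)
  also have "\<dots> = (\<Sum>i\<in>UNIV. \<Sum>j\<in>UNIV. 4 * dt u z * (sform i j)\<^sup>2 - sform i j * X j (X i u) z)"
    by (intro sum.cong refl swapped)
  also have "\<dots> = 4 * dt u z * (\<Sum>i\<in>(UNIV :: ('n + 'n) set). \<Sum>j\<in>UNIV. (sform i j)\<^sup>2) - ?A"
    by (simp add: sum_subtractf sum_distrib_left)
  finally show ?thesis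
    by (simp add: sum_sform_sq)
qed

text \<open>What \<open>2 * \<phi> * (sigma2 + 12 n T\<^sup>2)\<close> becomes after integration by
  parts: second derivatives fall on \<open>\<phi>\<close> only, and \<open>u\<close> enters through
  first derivatives.\<close>

definition hess_quad :: "('n::finite heisenberg \<Rightarrow> real) \<Rightarrow> ('n heisenberg \<Rightarrow> real) \<Rightarrow>
    'n heisenberg \<Rightarrow> real" where
  "hess_quad \<phi> u z = (\<Sum>i\<in>UNIV. \<Sum>j\<in>UNIV.
      X i u z * X j u z * X j (X i \<phi>) z - X j (X j \<phi>) z * (X i u z)\<^sup>2
      - 12 * sform i j * (X j \<phi> z * X i u z * dt u z))"

text \<open>The integrand is a sum of the expressions \<open>Z1\<close> to \<open>Z4\<close>, each
  of integral 0. The \<open>T\<^sup>2\<close> term has two sources: \<open>8 n\<close> from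
  symmetrizing the Hessian and \<open>16 n\<close> from the commutators in the integration by parts,
  together \<open>24 n\<close>.\<close>

lemma has_bochner_integral_sigma2:
  fixes u \<phi> :: "'n::finite heisenberg \<Rightarrow> real"
  assumes u: "C2_fun_on UNIV u" "compactly_supported u"
    and \<phi>: "C2_fun_on UNIV \<phi>" "compactly_supported \<phi>"
  shows "has_bochner_integral lborel (\<lambda>z.
    2 * \<phi> z * (sigma2 (heis_hessian u z) + 12 * real CARD('n) * (dt u z)\<^sup>2) - hess_quad \<phi> u z) 0"
proof -
  note C1 = C1_fun_on_X[OF u(1)] C1_fun_on_X[OF \<phi>(1)] C1_fun_on_dt[OF u(1)]
    C2_fun_on_imp_C1[OF \<phi>(1)] C2_fun_on_imp_C1[OF u(1)] C1_fun_on_mult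
  note diff = C1[THEN C1_fun_on_imp_differentiable[OF _ UNIV_I]]
  note cs = compactly_supported_X[OF u(2)] compactly_supported_X[OF \<phi>(2)] \<phi>(2)
    compactly_supported_mult(1)
  \<comment> \<open>\<open>Z1\<close> is the swap for \<open>\<phi> * X i u\<close> and
    \<open>X j u\<close>. \<open>Z2\<close> removes the derivative from \<open>dt u\<close> in its
    correction term, using \<open>dt_X\<close>. \<open>Z3\<close> and \<open>Z4\<close> remove
    second derivatives of \<open>u\<close> from the terms in which one derivative has fallen on
    \<open>\<phi>\<close>.\<close>
  define Z1 where "Z1 = (\<lambda>i j z. X i (\<lambda>z. \<phi> z * X i u z) z * X j (X j u) z
      - X j (\<lambda>z. \<phi> z * X i u z) z * X i (X j u) z - 4 * sform i j * (\<phi> z * X i u z * dt (X j u) z))"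
  define Z2 where "Z2 = (\<lambda>i j. X j (\<lambda>z. \<phi> z * X i u z * dt u z))"
  define Z3 where "Z3 = (\<lambda>i j. X j (\<lambda>z. X i \<phi> z * X i u z * X j u z))"
  define Z4 where "Z4 = (\<lambda>i j. X j (\<lambda>z. X j \<phi> z * X i u z * X i u z))"
  have Z1: "has_bochner_integral lborel (Z1 i j) 0" for i j
    unfolding Z1_def by (rule has_bochner_integral_X_swap) (intro C1 cs)+
  have Z2: "has_bochner_integral lborel (Z2 i j) 0" for i j
    unfolding Z2_def by (rule has_bochner_integral_X) (intro C1 cs)+
  have Z3: "has_bochner_integral lborel (Z3 i j) 0" for i j
    unfolding Z3_def by (rule has_bochner_integral_X) (intro C1 cs)+
  have Z4: "has_bochner_integral lborel (Z4 i j) 0" for i j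
    unfolding Z4_def by (rule has_bochner_integral_X) (intro C1 cs)+
  define Z where "Z = (\<lambda>z. \<Sum>i\<in>UNIV. \<Sum>j\<in>UNIV. Z1 i j z + 4 * sform i j * Z2 i j z - Z3 i j z + Z4 i j z)"
  have "has_bochner_integral lborel (\<lambda>z. Z1 i j z + 4 * sform i j * Z2 i j z - Z3 i j z + Z4 i j z) 0"
    for i j
    using has_bochner_integral_add[OF has_bochner_integral_diff[OF has_bochner_integral_add[OF Z1
          has_bochner_integral_mult_right[OF Z2]] Z3] Z4, of i j "4 * sform i j" i j i j i j]
    by simp
  then have "has_bochner_integral lborel Z (\<Sum>i\<in>(UNIV :: ('n + 'n) set). \<Sum>j\<in>(UNIV :: ('n + 'n) set). 0)"
    unfolding Z_def by (intro has_bochner_integral_sum)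
  then have "has_bochner_integral lborel Z 0"
    by simp
  moreover have "Z z = 2 * \<phi> z * (sigma2 (heis_hessian u z) + 12 * real CARD('n) * (dt u z)\<^sup>2)
      - hess_quad \<phi> u z" for z
  proof -
    \<comment> \<open>The second derivatives of \<open>u\<close> multiplied by derivatives of
      \<open>\<phi>\<close> that still remain are antisymmetric in \<open>i\<close> and
      \<open>j\<close>, so they cancel in the double sum. The coefficient 12 collects 4 from
      \<open>Z2\<close> and 4 from each of two commutations.\<close>
    define S where "S = (\<lambda>i j. X i \<phi> z * X j u z * X j (X i u) z)"
    have pointwise: "\<phi> z * (X i (X i u) z * X j (X j u) z - X j (X i u) z * X i (X j u) z) =
        (Z1 i j z + 4 * sform i j * Z2 i j z - Z3 i j z + Z4 i j z)
        + (X i u z * X j u z * X j (X i \<phi>) z - X j (X j \<phi>) z * (X i u z)\<^sup>2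
          - 12 * sform i j * (X j \<phi> z * X i u z * dt u z))
        + (S i j - S j i) - 4 * \<phi> z * dt u z * (sform i j * X j (X i u) z)" for i j
      unfolding Z1_def Z2_def Z3_def Z4_def S_def
      by (simp add: X_mult diff dt_X[OF u(1)] X_X_commute[OF u(1), of i j] power2_eq_square
          algebra_simps)
    have "(\<Sum>i\<in>UNIV. \<Sum>j\<in>UNIV. S i j - S j i) = 0"
      using sum.swap[of S UNIV UNIV] by (simp add: sum_subtractf)
    then have main: "\<phi> z * (\<Sum>i\<in>UNIV. \<Sum>j\<in>UNIV. X i (X i u) z * X j (X j u) z - X j (X i u) z * X i (X j u) z)
        = Z z + hess_quad \<phi> u z - 4 * \<phi> z * dt u z * (4 * real CARD('n) * dt u z)"
      unfolding Z_def hess_quad_def sum_distrib_left pointwise sum_sform_X_X[OF u(1), symmetric]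
      by (simp add: sum.distrib sum_subtractf)
    have "(\<Sum>i\<in>UNIV. \<Sum>j\<in>UNIV. X i (X i u) z * X j (X j u) z - X j (X i u) z * X i (X j u) z)
        = 2 * sigma2 (heis_hessian u z) + 8 * real CARD('n) * (dt u z)\<^sup>2"
      using two_sigma2_heis_hessian[OF u(1), of z] by simp
    from main[unfolded this] show ?thesis
      by (simp add: power2_eq_square algebra_simps)
  qed
  ultimately show ?thesis
    by (metis (no_types, lifting) ext)
qed

section \<open>Energy estimates\<close>

lemma X_diff_const:
  assumes "f differentiable (at z)"
  shows "X i (\<lambda>z. f z - c) z = X i f z"
  using assms by (simp add: X_eq dt_def dir_deriv_diff dir_deriv_const)

lemma trace_heis_hessian: "trace (heis_hessian u z) = (\<Sum>i\<in>UNIV. X i (X i u) z)"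
  by (simp add: trace_def heis_hessian_def)

lemma caccioppoli:
  fixes u \<zeta> :: "'n::finite heisenberg \<Rightarrow> real"
  assumes u: "C2_fun_on UNIV u" "compactly_supported u"
    and \<zeta>: "C2_fun_on UNIV \<zeta>" "compactly_supported \<zeta>"
    and range: "\<And>z. \<zeta> z \<noteq> 0 \<Longrightarrow> m \<le> u z \<and> u z \<le> m + d"
    and sub: "\<And>z. \<zeta> z \<noteq> 0 \<Longrightarrow> 0 \<le> trace (heis_hessian u z)"
  shows "(\<integral>z. (\<zeta> z)\<^sup>2 * (\<Sum>i\<in>UNIV. (X i u z)\<^sup>2) \<partial>lborel)
    \<le> 4 * d\<^sup>2 * (\<integral>z. (\<Sum>i\<in>UNIV. (X i \<zeta> z)\<^sup>2) \<partial>lborel)"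
proof -
  note C1 = C1_fun_on_X[OF u(1)] C1_fun_on_X[OF \<zeta>(1)] C2_fun_on_imp_C1[OF \<zeta>(1)]
    C2_fun_on_imp_C1[OF u(1)] C1_fun_on_mult C1_fun_on_diff C1_fun_on_const
  note diff = C1[THEN C1_fun_on_imp_differentiable[OF _ UNIV_I]]
  define V where "V = (\<lambda>i. X i (\<lambda>z. \<zeta> z * \<zeta> z * (u z - m) * X i u z))"
  have V: "has_bochner_integral lborel (V i) 0" for i
    unfolding V_def by (rule has_bochner_integral_X)
      (intro C1 compactly_supported_mult(1) \<zeta>(2))+
  have V_eq: "V i z = (\<zeta> z)\<^sup>2 * (X i u z)\<^sup>2 + 2 * \<zeta> z * (u z - m) * X i \<zeta> z * X i u z
      + (\<zeta> z)\<^sup>2 * (u z - m) * X i (X i u) z" for i z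
    unfolding V_def
    by (simp add: X_mult X_diff_const diff) (simp add: power2_eq_square algebra_simps)
  have sq: "integrable lborel (\<lambda>z. (X i \<zeta> z)\<^sup>2)" for i
    unfolding power2_eq_square using \<zeta>
    by (intro integrable_compactly_supported compactly_supported_mult(1) compactly_supported_X
        continuous_on_mult continuous_on_X C2_fun_on_imp_C1)
  have lhs: "integrable lborel (\<lambda>z. (\<zeta> z)\<^sup>2 * (\<Sum>i\<in>UNIV. (X i u z)\<^sup>2))"
    unfolding power2_eq_square using u \<zeta>
    by (intro integrable_compactly_supported compactly_supported_mult(1)
        continuous_on_mult continuous_on_sum continuous_on_X C2_fun_on_imp_C1
        C1_fun_on_imp_continuous)
  have "has_bochner_integral lborel
      (\<lambda>z. 2 * (\<Sum>i\<in>UNIV. V i z) + 4 * d\<^sup>2 * (\<Sum>i\<in>UNIV. (X i \<zeta> z)\<^sup>2))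
      (2 * (\<Sum>i\<in>(UNIV :: ('n + 'n) set). 0) + 4 * d\<^sup>2 * (\<integral>z. (\<Sum>i\<in>UNIV. (X i \<zeta> z)\<^sup>2) \<partial>lborel))"
    using sq by (intro has_bochner_integral_add has_bochner_integral_mult_right
        has_bochner_integral_sum V has_bochner_integral_integrable integrable_sum) auto
  then have rhs: "integrable lborel
      (\<lambda>z. 2 * (\<Sum>i\<in>UNIV. V i z) + 4 * d\<^sup>2 * (\<Sum>i\<in>UNIV. (X i \<zeta> z)\<^sup>2))"
    "(\<integral>z. 2 * (\<Sum>i\<in>UNIV. V i z) + 4 * d\<^sup>2 * (\<Sum>i\<in>UNIV. (X i \<zeta> z)\<^sup>2) \<partial>lborel)
      = 4 * d\<^sup>2 * (\<integral>z. (\<Sum>i\<in>UNIV. (X i \<zeta> z)\<^sup>2) \<partial>lborel)"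
    by (auto simp only: has_bochner_integral_iff sum.neutral_const mult_zero_right add_0)
  have "(\<zeta> z)\<^sup>2 * (\<Sum>i\<in>UNIV. (X i u z)\<^sup>2)
      \<le> 2 * (\<Sum>i\<in>UNIV. V i z) + 4 * d\<^sup>2 * (\<Sum>i\<in>UNIV. (X i \<zeta> z)\<^sup>2)" for z
  proof (cases "\<zeta> z = 0")
    case True
    then show ?thesis by (simp add: V_eq sum_nonneg)
  next
    case False
    define w where "w = u z - m"
    have w: "0 \<le> w" "w\<^sup>2 \<le> d\<^sup>2"
      using range[OF False] by (auto simp: w_def intro!: power_mono)
    have "(\<zeta> z)\<^sup>2 * (X i u z)\<^sup>2 + 2 * (\<zeta> z)\<^sup>2 * w * X i (X i u) z
        \<le> 2 * V i z + 4 * d\<^sup>2 * (X i \<zeta> z)\<^sup>2" for i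
    proof -
      \<comment> \<open>Completing the square in \<open>2 * V i z\<close> costs one of its two
        copies of the energy term and produces the constant 4.\<close>
      have "0 \<le> (\<zeta> z * X i u z + 2 * w * X i \<zeta> z)\<^sup>2"
        by simp
      moreover have "w\<^sup>2 * (X i \<zeta> z)\<^sup>2 \<le> d\<^sup>2 * (X i \<zeta> z)\<^sup>2"
        by (intro mult_right_mono w) simp
      ultimately show ?thesis
        unfolding V_eq w_def[symmetric] by (simp add: power2_eq_square algebra_simps)
    qed
    then have "(\<Sum>i\<in>UNIV. (\<zeta> z)\<^sup>2 * (X i u z)\<^sup>2 + 2 * (\<zeta> z)\<^sup>2 * w * X i (X i u) z)
        \<le> (\<Sum>i\<in>UNIV. 2 * V i z + 4 * d\<^sup>2 * (X i \<zeta> z)\<^sup>2)"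
      by (rule sum_mono)
    moreover have "0 \<le> 2 * (\<zeta> z)\<^sup>2 * w * (\<Sum>i\<in>UNIV. X i (X i u) z)"
      using sub[OF False] w by (simp add: trace_heis_hessian)
    ultimately show ?thesis
      by (simp add: sum.distrib sum_distrib_left)
  qed
  from integral_mono[OF lhs rhs(1) this] show ?thesis
    by (simp only: rhs(2))
qed

text \<open>The choice \<open>\<phi> = \<eta>\<^sup>2\<close> leaves a factor \<open>\<eta>\<close>
  in \<open>X j \<phi>\<close>, so that Young's inequality applies to the mixed term with
  \<open>\<eta> * dt u\<close> as one factor. The multiple of \<open>(dt u)\<^sup>2\<close> is half
  of what the integral identity provides.\<close>

lemma hess_quad_le:
  fixes u \<eta> :: "'n::finite heisenberg \<Rightarrow> real"
  assumes \<eta>: "C2_fun_on UNIV \<eta>"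
    and B1: "\<And>j. \<bar>X j \<eta> z\<bar> \<le> B"
    and B2: "\<And>i j. \<bar>X j (X i (\<lambda>z. \<eta> z * \<eta> z)) z\<bar> \<le> B"
  shows "hess_quad (\<lambda>z. \<eta> z * \<eta> z) u z \<le> 12 * real CARD('n) * (\<eta> z)\<^sup>2 * (dt u z)\<^sup>2
    + (4 * B + 48 * B\<^sup>2) * real CARD('n) * (\<Sum>i\<in>UNIV. (X i u z)\<^sup>2)"
proof -
  have B: "B \<ge> 0"
    using B1 abs_ge_zero order_trans by blast
  have X\<eta>: "X j (\<lambda>z. \<eta> z * \<eta> z) z = 2 * \<eta> z * X j \<eta> z" for j
    by (simp add: X_mult C1_fun_on_imp_differentiable[OF C2_fun_on_imp_C1[OF \<eta>]])
  define f where "f = (\<lambda>i. X i u z)"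
  have termwise: "f i * f j * X j (X i (\<lambda>z. \<eta> z * \<eta> z)) z - X j (X j (\<lambda>z. \<eta> z * \<eta> z)) z * (f i)\<^sup>2
      - 12 * sform i j * (X j (\<lambda>z. \<eta> z * \<eta> z) z * f i * dt u z)
      \<le> B / 2 * ((f i)\<^sup>2 + (f j)\<^sup>2) + B * (f i)\<^sup>2
        + (6 * (\<eta> z)\<^sup>2 * (dt u z)\<^sup>2 * (sform i j)\<^sup>2 + 24 * B\<^sup>2 * (f i)\<^sup>2)" for i j
  proof -
    have "f i * f j * X j (X i (\<lambda>z. \<eta> z * \<eta> z)) z \<le> \<bar>f i * f j\<bar> * B"
      using mult_left_mono[OF B2[of j i] abs_ge_zero[of "f i * f j"]]
        abs_ge_self[of "f i * f j * X j (X i (\<lambda>z. \<eta> z * \<eta> z)) z"]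
      unfolding abs_mult by linarith
    also have "\<dots> \<le> ((f i)\<^sup>2 + (f j)\<^sup>2) / 2 * B"
    proof (rule mult_right_mono[OF _ B])
      show "\<bar>f i * f j\<bar> \<le> ((f i)\<^sup>2 + (f j)\<^sup>2) / 2"
        using zero_le_power2[of "\<bar>f i\<bar> - \<bar>f j\<bar>"] by (simp add: power2_diff abs_mult)
    qed
    finally have 1: "f i * f j * X j (X i (\<lambda>z. \<eta> z * \<eta> z)) z \<le> B / 2 * ((f i)\<^sup>2 + (f j)\<^sup>2)"
      by (simp add: mult.commute)
    have 2: "- (X j (X j (\<lambda>z. \<eta> z * \<eta> z)) z * (f i)\<^sup>2) \<le> B * (f i)\<^sup>2"
      using mult_right_mono[of "- X j (X j (\<lambda>z. \<eta> z * \<eta> z)) z" B "(f i)\<^sup>2"] B2[of j j] by auto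
    have "- 12 * sform i j * (X j (\<lambda>z. \<eta> z * \<eta> z) z * f i * dt u z)
        = - 24 * (\<eta> z * dt u z * sform i j) * (X j \<eta> z * f i)"
      by (simp add: X\<eta>)
    \<comment> \<open>The weight 6 is chosen because the squares of \<open>sform\<close> sum to
      \<open>2n\<close>, which gives exactly \<open>12 n\<close> in the end.\<close>
    also have "\<dots> \<le> 6 * (\<eta> z * dt u z * sform i j)\<^sup>2 + 24 * (X j \<eta> z * f i)\<^sup>2"
      using zero_le_power2[of "(\<eta> z * dt u z * sform i j) + 2 * (X j \<eta> z * f i)"]
      by (simp add: power2_eq_square algebra_simps)
    also have "(X j \<eta> z)\<^sup>2 \<le> B\<^sup>2"
      using B1[of j] B by (simp add: abs_le_square_iff[symmetric])
    then have "(X j \<eta> z * f i)\<^sup>2 \<le> B\<^sup>2 * (f i)\<^sup>2"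
      by (simp add: power_mult_distrib mult_right_mono)
    finally have 3: "- 12 * sform i j * (X j (\<lambda>z. \<eta> z * \<eta> z) z * f i * dt u z)
        \<le> 6 * (\<eta> z)\<^sup>2 * (dt u z)\<^sup>2 * (sform i j)\<^sup>2 + 24 * B\<^sup>2 * (f i)\<^sup>2"
      by (simp add: power_mult_distrib)
    from 1 2 3 show ?thesis by linarith
  qed
  have "hess_quad (\<lambda>z. \<eta> z * \<eta> z) u z \<le> (\<Sum>i\<in>UNIV. \<Sum>j\<in>UNIV. B / 2 * ((f i)\<^sup>2 + (f j)\<^sup>2) + B * (f i)\<^sup>2
        + (6 * (\<eta> z)\<^sup>2 * (dt u z)\<^sup>2 * (sform i j)\<^sup>2 + 24 * B\<^sup>2 * (f i)\<^sup>2))"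
    unfolding hess_quad_def f_def[symmetric] by (intro sum_mono termwise[unfolded f_def] | simp only: f_def)+
  also have "\<dots> = 12 * real CARD('n) * (\<eta> z)\<^sup>2 * (dt u z)\<^sup>2
    + (4 * B + 48 * B\<^sup>2) * real CARD('n) * (\<Sum>i\<in>UNIV. (f i)\<^sup>2)"
  proof -
    have card: "real CARD('n + 'n) = 2 * real CARD('n)"
      by simp
    show ?thesis
      by (simp only: sum.distrib sum_distrib_left[symmetric] sum_sform_sq sum_constant card
          distrib_left) (simp add: algebra_simps sum_distrib_left)
  qed
  finally show ?thesis
    by (simp add: f_def)
qed

text \<open>Combines the integral identity with absorption and Caccioppoli's inequality. Since
  \<open>\<zeta>\<close> is 1 on \<open>L\<close>, the energy weighted by
  \<open>\<zeta>\<^sup>2\<close> controls the gradient terms wherever \<open>\<eta>\<close> is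
  nonzero.\<close>

lemma set_integral_sigma2_le:
  fixes u \<eta> \<zeta> :: "'n::finite heisenberg \<Rightarrow> real"
  assumes u: "C2_fun_on UNIV u" "compactly_supported u"
    and \<eta>: "C2_fun_on UNIV \<eta>" "compact L" "\<And>z. z \<notin> L \<Longrightarrow> \<eta> z = 0" "\<And>z. z \<in> A \<Longrightarrow> \<eta> z = 1"
    and \<zeta>: "C2_fun_on UNIV \<zeta>" "compactly_supported \<zeta>" "\<And>z. z \<in> L \<Longrightarrow> \<zeta> z = 1"
    and B1: "\<And>j z. \<bar>X j \<eta> z\<bar> \<le> B"
    and B2: "\<And>i j z. \<bar>X j (X i (\<lambda>z. \<eta> z * \<eta> z)) z\<bar> \<le> B"
    and range: "\<And>z. \<zeta> z \<noteq> 0 \<Longrightarrow> m \<le> u z \<and> u z \<le> m + d"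
    and convex: "\<And>z. \<zeta> z \<noteq> 0 \<Longrightarrow>
      0 \<le> trace (heis_hessian u z) \<and> 0 \<le> sigma2 (heis_hessian u z)"
  shows "(LINT z:A|lebesgue. sigma2 (heis_hessian u z) + 12 * real CARD('n) * (dt u z)\<^sup>2)
    \<le> (4 * B + 48 * B\<^sup>2) * real CARD('n) *
      (4 * d\<^sup>2 * (\<integral>z. (\<Sum>i\<in>UNIV. (X i \<zeta> z)\<^sup>2) \<partial>lborel))"
proof -
  define E where "E = (\<lambda>z. sigma2 (heis_hessian u z) + 12 * real CARD('n) * (dt u z)\<^sup>2)"
  define K where "K = (4 * B + 48 * B\<^sup>2) * real CARD('n)"
  define N where "N = (\<lambda>z. (\<zeta> z)\<^sup>2 * (\<Sum>i\<in>UNIV. (X i u z)\<^sup>2))"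
  define \<phi> where "\<phi> = (\<lambda>z. \<eta> z * \<eta> z)"
  \<comment> \<open>By the integral identity the bracket integrates to 0, so the integral of
    \<open>R\<close> is \<open>K\<close> times that of \<open>N\<close>; pointwise \<open>R\<close>
    dominates \<open>\<phi> z * E z\<close>.\<close>
  define R where "R = (\<lambda>z. (2 * \<phi> z * E z - hess_quad \<phi> u z) + K * N z)"
  have "B \<ge> 0"
    using B1 abs_ge_zero order_trans by blast
  then have K: "K \<ge> 0"
    by (simp add: K_def)
  have \<phi>: "C2_fun_on UNIV \<phi>" "compactly_supported \<phi>"
    unfolding \<phi>_def using \<eta>
    by (auto intro!: C2_fun_on_mult compactly_supported_mult(1) simp: compactly_supported_def)
  have N: "integrable lborel N"
    unfolding N_def power2_eq_square using u \<zeta>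
    by (intro integrable_compactly_supported compactly_supported_mult(1)
        continuous_on_mult continuous_on_sum continuous_on_X C2_fun_on_imp_C1
        C1_fun_on_imp_continuous)
  have R: "has_bochner_integral lborel R (0 + K * integral\<^sup>L lborel N)"
    unfolding R_def E_def
    by (intro has_bochner_integral_add has_bochner_integral_sigma2 u \<phi>
        has_bochner_integral_mult_right has_bochner_integral_integrable N)
  have "\<phi> z * E z \<le> R z \<and> 0 \<le> \<phi> z * E z" for z
  proof (cases "z \<in> L")
    case True
    then have "\<zeta> z = 1" by (rule \<zeta>(3))
    then have s: "0 \<le> sigma2 (heis_hessian u z)"
      using convex by simp
    have "hess_quad \<phi> u z \<le> 12 * real CARD('n) * (\<eta> z)\<^sup>2 * (dt u z)\<^sup>2
        + K * (\<Sum>i\<in>UNIV. (X i u z)\<^sup>2)"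
      unfolding \<phi>_def K_def by (rule hess_quad_le[OF \<eta>(1) B1 B2])
    \<comment> \<open>The absorption: \<open>sigma2 \<ge> 0\<close> lets one of the two copies of
      \<open>\<phi> z * E z\<close> in \<open>R\<close> pay for the \<open>dt u\<close>
      term.\<close>
    also have "12 * real CARD('n) * (\<eta> z)\<^sup>2 * (dt u z)\<^sup>2 \<le> \<phi> z * E z"
      using mult_nonneg_nonneg[OF zero_le_power2[of "\<eta> z"] s]
      by (simp add: \<phi>_def E_def power2_eq_square algebra_simps)
    finally have "hess_quad \<phi> u z \<le> \<phi> z * E z + K * N z"
      using \<open>\<zeta> z = 1\<close> by (simp add: N_def)
    moreover have "0 \<le> \<phi> z * E z"
      using s by (simp add: \<phi>_def E_def)
    ultimately show ?thesis
      unfolding R_def by linarith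
  next
    case False
    \<comment> \<open>Off \<open>L\<close> the cutoff vanishes on an open set, hence so do its
      derivatives, and \<open>R\<close> reduces to \<open>K * N \<ge> 0\<close>.\<close>
    have "open (- L)" "z \<in> - L"
      using False \<eta>(2) by (auto simp: compact_imp_closed)
    moreover have "\<phi> w = 0" if "w \<in> - L" for w
      using that \<eta>(3) by (simp add: \<phi>_def)
    ultimately have X\<phi>: "X i \<phi> w = 0" if "w \<in> - L" for i w
      using X_cong[of "- L" w \<phi> "\<lambda>_. 0" i] that by (simp add: X_eq dt_def dir_deriv_const)
    have "X j (X i \<phi>) z = 0" for i j
      using X_cong[of "- L" z "X i \<phi>" "\<lambda>_. 0" j] X\<phi> \<open>open (- L)\<close> \<open>z \<in> - L\<close>
      by (simp add: X_eq dt_def dir_deriv_const)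
    then have "hess_quad \<phi> u z = 0"
      using X\<phi>[OF \<open>z \<in> - L\<close>] by (simp add: hess_quad_def)
    moreover have "\<phi> z = 0"
      using False \<eta>(3) by (simp add: \<phi>_def)
    ultimately show ?thesis
      using K by (simp add: R_def N_def sum_nonneg)
  qed
  note bound = this
  have "(LINT z:A|lebesgue. E z) \<le> integral\<^sup>L lebesgue R"
    unfolding set_lebesgue_integral_def
  proof (rule integral_mono')
    show "integrable lebesgue R"
      using R by (auto simp: has_bochner_integral_iff integrable_completion
          dest: borel_measurable_integrable)
    show "indicat_real A z *\<^sub>R E z \<le> R z" for z
      using bound[of z] \<eta>(4)[of z] by (cases "z \<in> A") (auto simp: \<phi>_def)
    show "0 \<le> R z" for z
      using bound[of z] by linarith
  qed
  also have "\<dots> = K * integral\<^sup>L lborel N"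
    using R by (auto simp: has_bochner_integral_iff integral_completion
        dest: borel_measurable_integrable)
  also have "\<dots> \<le> K * (4 * d\<^sup>2 * (\<integral>z. (\<Sum>i\<in>UNIV. (X i \<zeta> z)\<^sup>2) \<partial>lborel))"
    unfolding N_def
    by (intro mult_left_mono K caccioppoli[OF u \<zeta>(1,2) range]) (use convex in auto)
  finally show ?thesis
    by (simp add: E_def K_def)
qed

section \<open>Uniform bounds, oscillation and conclusion\<close>

lemma finite_family_bound:
  fixes f :: "'i \<Rightarrow> 'a::topological_space \<Rightarrow> real"
  assumes "finite I" "\<And>i. i \<in> I \<Longrightarrow> compactly_supported (f i)"
    "\<And>i. i \<in> I \<Longrightarrow> continuous_on UNIV (f i)"
  obtains B where "\<And>i z. i \<in> I \<Longrightarrow> \<bar>f i z\<bar> \<le> B"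
proof -
  have "\<exists>M\<ge>0. \<forall>z. \<bar>f i z\<bar> \<le> M" if "i \<in> I" for i
    using compactly_supported_bounded assms(2,3) that by metis
  then obtain M where M: "\<And>i. i \<in> I \<Longrightarrow> M i \<ge> 0" "\<And>i z. i \<in> I \<Longrightarrow> \<bar>f i z\<bar> \<le> M i"
    by metis
  have "\<bar>f i z\<bar> \<le> sum M I" if "i \<in> I" for i z
    using M(2)[OF that, of z] member_le_sum[OF that, of M] M(1) assms(1) by force
  then show ?thesis by (rule that)
qed

text \<open>Separates the case in which the inequality is trivial from the one in which real bounds
  \<open>m\<close> and \<open>m + d\<close> are available.\<close>

lemma osc_finite_cases:
  fixes u :: "'a \<Rightarrow> real"
  obtains "(osc S u)\<^sup>2 = \<infinity>"
  | m d where "osc S u = ereal d" "\<And>z. z \<in> S \<Longrightarrow> m \<le> u z \<and> u z \<le> m + d"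
proof (cases "S = {}")
  case True
  then show ?thesis
    \<comment> \<open>On the empty set the supremum is \<open>-\<infinity>\<close> and the infimum
      is \<open>\<infinity>\<close>, so \<open>osc\<close> is \<open>-\<infinity>\<close>; its
      square is \<open>\<infinity>\<close>.\<close>
    by (intro that(1)) (simp add: osc_def bot_ereal_def top_ereal_def power2_eq_square)
next
  case False
  then obtain z0 where z0: "z0 \<in> S" by auto
  define M m where "M = (SUP z\<in>S. ereal (u z))" and "m = (INF z\<in>S. ereal (u z))"
  have M: "ereal (u z) \<le> M" and m: "m \<le> ereal (u z)" if "z \<in> S" for z
    using that by (auto simp: M_def m_def intro: SUP_upper INF_lower)
  have osc: "osc S u = M - m"
    by (simp add: osc_def M_def m_def)
  show ?thesis
  proof (cases "M = \<infinity> \<or> m = - \<infinity>")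
    case True
    then have "osc S u = \<infinity>"
      using M[OF z0] m[OF z0] unfolding osc by (cases M; cases m) auto
    then show ?thesis
      by (intro that(1)) (simp add: power2_eq_square)
  next
    case False
    then obtain M' m' where eq: "M = ereal M'" "m = ereal m'"
      using M[OF z0] m[OF z0] by (cases M; cases m) auto
    show ?thesis
    proof (rule that(2))
      show "osc S u = ereal (M' - m')"
        by (simp add: osc eq)
      show "m' \<le> u z \<and> u z \<le> m' + (M' - m')" if "z \<in> S" for z
        using M[OF that] m[OF that] by (simp add: eq)
    qed
  qed
qed

theorem proposition4p2:
  fixes \<Omega> \<Omega>' :: "'n::finite heisenberg set"
  assumes "open \<Omega>"
    and "\<Omega>' \<in> sets lebesgue"
    and "compact (closure \<Omega>')"
    and "closure \<Omega>' \<subseteq> \<Omega>"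
  shows "\<exists>C::real. C > 0 \<and>
    (\<forall>u. sigma2_H_convex_on \<Omega> u \<longrightarrow>
      ereal (LINT z:\<Omega>'|lebesgue.
          sigma2 (heis_hessian u z) + 12 * real CARD('n) * (dt u z)\<^sup>2)
        \<le> ereal C * (osc \<Omega> u)\<^sup>2)"
proof -
  \<comment> \<open>Three nested cutoffs, fixed before \<open>u\<close>: \<open>\<eta>\<close>
    localizes the integral, \<open>\<zeta>\<close> is used in Caccioppoli's inequality and is 1 near
    \<open>L1\<close>, and \<open>\<psi>\<close> is 1 near \<open>L2\<close> and serves to extend
    \<open>u\<close> to the whole space.\<close>
  obtain \<eta> L1 U1 where \<eta>: "C2_fun_on UNIV \<eta>" "compact L1" "L1 \<subseteq> \<Omega>"
    "\<And>z. z \<notin> L1 \<Longrightarrow> \<eta> z = 0" "closure \<Omega>' \<subseteq> U1" "\<And>z. z \<in> U1 \<Longrightarrow> \<eta> z = 1"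
    using C2_cutoff[OF assms(3,1,4)] by metis
  obtain \<zeta> L2 U2 where \<zeta>: "C2_fun_on UNIV \<zeta>" "compact L2" "L2 \<subseteq> \<Omega>"
    "\<And>z. z \<notin> L2 \<Longrightarrow> \<zeta> z = 0" "L1 \<subseteq> U2" "\<And>z. z \<in> U2 \<Longrightarrow> \<zeta> z = 1"
    using C2_cutoff[OF \<eta>(2) assms(1) \<eta>(3)] by metis
  obtain \<psi> L3 U3 where \<psi>: "C2_fun_on UNIV \<psi>" "compact L3" "L3 \<subseteq> \<Omega>"
    "\<And>z. z \<notin> L3 \<Longrightarrow> \<psi> z = 0" "open U3" "L2 \<subseteq> U3" "\<And>z. z \<in> U3 \<Longrightarrow> \<psi> z = 1"
    using C2_cutoff[OF \<zeta>(2) assms(1) \<zeta>(3)] by metis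
  have cs: "compactly_supported \<eta>" "compactly_supported \<zeta>"
    using \<eta>(2,4) \<zeta>(2,4) by (auto simp: compactly_supported_def)
  have \<eta>2: "C2_fun_on UNIV (\<lambda>z. \<eta> z * \<eta> z)" "compactly_supported (\<lambda>z. \<eta> z * \<eta> z)"
    using \<eta>(1) cs(1) by (auto intro: C2_fun_on_mult compactly_supported_mult)
  obtain B1 where B1: "\<And>j z. \<bar>X j \<eta> z\<bar> \<le> B1"
    using finite_family_bound[of UNIV "\<lambda>j. X j \<eta>"] compactly_supported_X[OF cs(1)]
      continuous_on_X[OF C2_fun_on_imp_C1[OF \<eta>(1)]] by (metis UNIV_I finite)
  obtain B2 where B2: "\<And>p z. \<bar>X (fst p) (X (snd p) (\<lambda>z. \<eta> z * \<eta> z)) z\<bar> \<le> B2"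
    using finite_family_bound[of UNIV "\<lambda>p. X (fst p) (X (snd p) (\<lambda>z. \<eta> z * \<eta> z))"]
      compactly_supported_X[OF compactly_supported_X[OF \<eta>2(2)]]
      continuous_on_X[OF C1_fun_on_X[OF \<eta>2(1)]] by (metis UNIV_I finite)
  define B where "B = max B1 B2"
  have B: "\<bar>X j \<eta> z\<bar> \<le> B" "\<bar>X j (X i (\<lambda>z. \<eta> z * \<eta> z)) z\<bar> \<le> B" for i j z
    using B1[of j z] B2[of "(j, i)" z] by (auto simp: B_def)
  \<comment> \<open>Only \<open>\<eta>\<close> and \<open>\<zeta>\<close> enter. The added 1 makes
    \<open>C\<close> positive even if \<open>X i \<zeta>\<close> or \<open>B\<close>
    vanishes.\<close>
  define C where "C = (4 * B + 48 * B\<^sup>2) * real CARD('n) *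
      (4 * (\<integral>z. (\<Sum>i\<in>UNIV. (X i \<zeta> z)\<^sup>2) \<partial>lborel)) + 1"
  have "B \<ge> 0"
    using B(1) abs_ge_zero order_trans by blast
  then have "C > 0"
    unfolding C_def by (intro add_nonneg_pos mult_nonneg_nonneg Bochner_Integration.integral_nonneg
        sum_nonneg) auto
  moreover have "ereal (LINT z:\<Omega>'|lebesgue.
      sigma2 (heis_hessian u z) + 12 * real CARD('n) * (dt u z)\<^sup>2) \<le> ereal C * (osc \<Omega> u)\<^sup>2"
    if u: "sigma2_H_convex_on \<Omega> u" for u
  proof (rule osc_finite_cases[of \<Omega> u])
    assume "(osc \<Omega> u)\<^sup>2 = \<infinity>"
    then show ?thesis
      using \<open>C > 0\<close> by simp
  next
    fix m d
    assume d: "osc \<Omega> u = ereal d" and range: "\<And>z. z \<in> \<Omega> \<Longrightarrow> m \<le> u z \<and> u z \<le> m + d"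
    \<comment> \<open>\<open>v\<close> is of class C2 on \<open>\<Omega>\<close> as a product and on
      \<open>- L3\<close> because it vanishes there. These open sets cover the space since
      \<open>L3 \<subseteq> \<Omega>\<close>.\<close>
    define v where "v = (\<lambda>z. \<psi> z * u z)"
    have "C2_fun_on \<Omega> u"
      using u assms(1) by (auto simp: sigma2_H_convex_on_def intro: C2_on_imp_C2_fun_on)
    then have "C2_fun_on \<Omega> v"
      unfolding v_def using assms(1) C2_fun_on_subset[OF \<psi>(1)] by (intro C2_fun_on_mult) auto
    moreover have open_compl: "open (- L3)"
      using \<psi>(2) by (intro open_Compl compact_imp_closed)
    then have "C2_fun_on (- L3) v"
      by (rule C2_fun_on_cong[OF _ _ C2_fun_on_const[OF open_compl, of 0]])
        (auto simp: v_def \<psi>(4))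
    ultimately have "C2_fun_on (\<Omega> \<union> - L3) v"
      using assms(1) open_compl by (intro C2_fun_on_Un)
    moreover have "\<Omega> \<union> - L3 = UNIV"
      using \<psi>(3) by auto
    ultimately have v: "C2_fun_on UNIV v" by simp
    have v_cs: "compactly_supported v"
      unfolding v_def using \<psi>(2,4) by (intro compactly_supported_mult(1)) (auto simp: compactly_supported_def)
    have v_eq: "v z = u z" if "z \<in> U3" for z
      using \<psi>(7)[OF that] by (simp add: v_def)
    \<comment> \<open>Agreement of \<open>v\<close> and \<open>u\<close> on the open set
      \<open>U3\<close> around \<open>L2\<close> is what makes their derivatives agree on
      \<open>L2\<close>.\<close>
    have H_eq: "heis_hessian v z = heis_hessian u z" and dt_eq: "dt v z = dt u z" if "z \<in> L2" for z
    proof -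
      have z: "z \<in> U3"
        using \<psi>(6) that by auto
      show "heis_hessian v z = heis_hessian u z"
        by (rule heis_hessian_cong[OF \<psi>(5) z v_eq])
      show "dt v z = dt u z"
        by (rule dt_cong[OF \<psi>(5) z v_eq])
    qed
    have \<Omega>'_L2: "z \<in> L2" "\<eta> z = 1" if "z \<in> \<Omega>'" for z
    proof -
      show "\<eta> z = 1"
        using that \<eta>(5,6) closure_subset by blast
      then have "\<zeta> z = 1"
        using \<eta>(4)[of z] \<zeta>(5) \<zeta>(6)[of z] by auto
      then show "z \<in> L2"
        using \<zeta>(4)[of z] by auto
    qed
    have "(LINT z:\<Omega>'|lebesgue. sigma2 (heis_hessian u z) + 12 * real CARD('n) * (dt u z)\<^sup>2)
        = (LINT z:\<Omega>'|lebesgue. sigma2 (heis_hessian v z) + 12 * real CARD('n) * (dt v z)\<^sup>2)"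
      unfolding set_lebesgue_integral_def
      by (rule Bochner_Integration.integral_cong)
        (auto simp: indicator_def H_eq[OF \<Omega>'_L2(1)] dt_eq[OF \<Omega>'_L2(1)])
    also have "\<dots> \<le> (4 * B + 48 * B\<^sup>2) * real CARD('n) *
      (4 * d\<^sup>2 * (\<integral>z. (\<Sum>i\<in>UNIV. (X i \<zeta> z)\<^sup>2) \<partial>lborel))"
    proof (rule set_integral_sigma2_le[OF v v_cs \<eta>(1,2,4) \<Omega>'_L2(2) \<zeta>(1) cs(2) _ B])
      show "\<zeta> z = 1" if "z \<in> L1" for z
        using that \<zeta>(5) \<zeta>(6)[of z] by auto
      fix z assume "\<zeta> z \<noteq> 0"
      then have z: "z \<in> L2" "z \<in> \<Omega>" "z \<in> U3"
        using \<zeta>(3) \<zeta>(4)[of z] \<psi>(6) by auto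
      show "m \<le> v z \<and> v z \<le> m + d"
        using range[OF z(2)] v_eq[OF z(3)] by simp
      show "0 \<le> trace (heis_hessian v z) \<and> 0 \<le> sigma2 (heis_hessian v z)"
        using u z(2) H_eq[OF z(1)] by (simp add: sigma2_H_convex_on_def)
    qed
    also have "\<dots> \<le> C * d\<^sup>2"
      by (simp add: C_def algebra_simps)
    finally show ?thesis
      by (simp add: d power2_eq_square)
  qed
  ultimately show ?thesis
    by blast
qed

end
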